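(* There exists a sequence of compact embedded minimal disks $M_N\subset \mathbb{R}^2\times[-1/2,1/2]\subset\mathbb{R}^3$ with $0\in M_N$, each containing the vertical segment $\{(0,0,t) : |t|\le 1/2\}\subset M_N$, with the following properties: (a) For every $p\in\{(0,0,t) : -1/2\le t\le 0\}$, $\lim_{N\to\infty}|A_{M_N}|^2(p)=\infty$. (b) For every $N$, $M_N\setminus\{(0,0,t) : |t|\le 1/2\}=M_{1,N}\cup M_{2,N}$ for multi-valued graphs $M_{1,N}$, $M_{2,N}$ over the punctured plane $\{x_3=0\}\setminus\{0\}$. (c) For every $\delta>0$ there is a constant $C_\delta$ depending on $\delta$ with $\sup_N\sup_{M_N\setminus B_\delta}|A_{M_N}|^2=C_\delta<\infty$, where $B_\delta$ is a $\delta$-neighborhood of $\{(0,0,t) : -1/2\le t\le 0\}$. (d) There is $r_0>0$ not depending on $N$ such that for every $N$ the boundary $\partial M_N$ lies outside the cylinder $\{(x_1,x_2,x_3) : x_1^2+x_2^2\le r_0^2,\ -1/2<x_3<1/2\}$. Moreover, for each $t$ with $-1/2\le t\le 0$, the distance from the $x_3$-axis to the boundary of the horizontal slice $\{x_3=t\}\cap M_N$ goes to infinity as $N\to\infty$.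
   Context: $(x_1,x_2,x_3)$ are standard coordinates on $\mathbb{R}^3$. For a smooth surface $\Sigma$ immersed in $\mathbb{R}^3$, $A_\Sigma$ denotes its second fundamental form (so $|A_\Sigma|^2=-2K_\Sigma$ when $\Sigma$ is minimal, $K_\Sigma$ being the Gauss curvature). Multi-valued graph over the punctured plane (standard notion): let $\mathcal{P}=\{(\rho,\theta) : \rho>0,\ \theta\in\mathbb{R}\}$ be the universal cover of $\{x_3=0\}\setminus\{0\}$ in polar coordinates; a multi-valued graph is a surface of the form $\{(\rho\cos\theta,\rho\sin\theta,u(\rho,\theta)) : (\rho,\theta)\in D\}$ for a function $u$ on a domain $D\subset\mathcal{P}$ (with boundary points allowed in $D$). In (d), the boundary of the slice $\{x_3=t\}\cap M_N$ means the endpoints of this slice, regarded as an arc in the plane $\{x_3=t\}$; for $-1/2<t\le 0$ these are the points of $\partial M_N$ at height $t$. *)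

theory Defs
  imports "HOL-Analysis.Analysis"
begin

section \<open>Smooth maps\<close>

text \<open>Only used on open sets, where the Frechet derivative is unique.\<close>

fun Ck_on :: "nat \<Rightarrow> 'a::euclidean_space set \<Rightarrow> ('a \<Rightarrow> 'b::euclidean_space) \<Rightarrow> bool" where
  "Ck_on 0 S f \<longleftrightarrow> continuous_on S f"
| "Ck_on (Suc k) S f \<longleftrightarrow>
     (\<forall>x\<in>S. f differentiable (at x)) \<and> (\<forall>v. Ck_on k S (\<lambda>x. frechet_derivative f (at x) v))"

definition smooth_on :: "'a::euclidean_space set \<Rightarrow> ('a \<Rightarrow> 'b::euclidean_space) \<Rightarrow> bool" where
  "smooth_on S f \<longleftrightarrow> (\<forall>k. Ck_on k S f)"


section \<open>Parametrized surfaces in three-space\<close>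

text \<open>The parameter plane is the type of complex numbers, regarded as the real plane with
  coordinate directions \<open>1\<close> and \<open>\<i>\<close>.\<close>

definition coord_dir :: "2 \<Rightarrow> complex" where
  "coord_dir i = (if i = 1 then 1 else \<i>)"

definition pdiff :: "2 \<Rightarrow> (complex \<Rightarrow> real^3) \<Rightarrow> complex \<Rightarrow> real^3" where
  "pdiff i F z = frechet_derivative F (at z) (coord_dir i)"

definition unit_normal :: "(complex \<Rightarrow> real^3) \<Rightarrow> complex \<Rightarrow> real^3" where
  "unit_normal F z = (let n = cross3 (pdiff 1 F z) (pdiff 2 F z) in n /\<^sub>R norm n)"

definition first_fundamental_form :: "(complex \<Rightarrow> real^3) \<Rightarrow> complex \<Rightarrow> real^2^2" where
  "first_fundamental_form F z = (\<chi> i j. pdiff i F z \<bullet> pdiff j F z)"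

definition second_fundamental_form :: "(complex \<Rightarrow> real^3) \<Rightarrow> complex \<Rightarrow> real^2^2" where
  "second_fundamental_form F z = (\<chi> i j. pdiff i (pdiff j F) z \<bullet> unit_normal F z)"

definition shape_operator :: "(complex \<Rightarrow> real^3) \<Rightarrow> complex \<Rightarrow> real^2^2" where
  "shape_operator F z = matrix_inv (first_fundamental_form F z) ** second_fundamental_form F z"

definition mean_curvature :: "(complex \<Rightarrow> real^3) \<Rightarrow> complex \<Rightarrow> real" where
  "mean_curvature F z = trace (shape_operator F z) / 2"

text \<open>The squared norm of the second fundamental form \<open>A\<close> with respect to the induced metric
  \<open>g\<close>: \<open>g\<^sup>i\<^sup>k g\<^sup>j\<^sup>l A\<^sub>i\<^sub>j A\<^sub>k\<^sub>l = tr (g\<inverse> A g\<inverse> A)\<close>.\<close>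

definition sff_norm_sq :: "(complex \<Rightarrow> real^3) \<Rightarrow> complex \<Rightarrow> real" where
  "sff_norm_sq F z = trace (shape_operator F z ** shape_operator F z)"


section \<open>Compact embedded minimal disks\<close>

text \<open>A closed topological disk in the plane whose boundary is a piecewise regular \<open>C\<^sup>1\<close> closed
  curve. Corners must be admitted: a disk contained in a slab may have whole arcs
  of its boundary on the faces of the slab.\<close>

definition closed_disk_domain :: "complex set \<Rightarrow> bool" where
  "closed_disk_domain D \<longleftrightarrow>
     D homeomorphic (cball 0 1 :: complex set) \<and>
     (\<exists>\<gamma> S. simple_path \<gamma> \<and> pathfinish \<gamma> = pathstart \<gamma> \<and> path_image \<gamma> = frontier D \<and>
        finite S \<and> \<gamma> C1_differentiable_on ({0..1} - S) \<and>
        (\<forall>t\<in>{0..1} - S. vector_derivative \<gamma> (at t) \<noteq> 0))"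

text \<open>\<open>M\<close> is a compact embedded minimal disk, with parametrization \<open>F\<close> over \<open>D\<close>. It is smooth
  up to and including the boundary (\<open>F\<close> is smooth near \<open>D\<close>), so that curvature makes sense at
  boundary points as well. As \<open>D\<close> is compact, injectivity makes \<open>F\<close> a topological embedding of \<open>D\<close>.\<close>

definition compact_embedded_minimal_disk ::
    "complex set \<Rightarrow> (complex \<Rightarrow> real^3) \<Rightarrow> (real^3) set \<Rightarrow> bool" where
  "compact_embedded_minimal_disk D F M \<longleftrightarrow>
     closed_disk_domain D \<and>
     (\<exists>U. open U \<and> D \<subseteq> U \<and> smooth_on U F) \<and>
     inj_on F D \<and>
     (\<forall>z\<in>D. inj (frechet_derivative F (at z))) \<and>
     (\<forall>z\<in>D. mean_curvature F z = 0) \<and>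
     M = F ` D"

text \<open>The value of the squared norm of the second fundamental form at a point \<open>p\<close> of the embedded
  surface \<open>F ` D\<close>.\<close>

definition sff_norm_sq_at :: "complex set \<Rightarrow> (complex \<Rightarrow> real^3) \<Rightarrow> real^3 \<Rightarrow> real" where
  "sff_norm_sq_at D F p = sff_norm_sq F (inv_into D F p)"

text \<open>The boundary as a surface; the topological frontier of \<open>F ` D\<close> in space
  would be all of \<open>F ` D\<close>.\<close>

definition disk_boundary :: "complex set \<Rightarrow> (complex \<Rightarrow> real^3) \<Rightarrow> (real^3) set" where
  "disk_boundary D F = F ` frontier D"


section \<open>Multi-valued graphs over the punctured plane\<close>

text \<open>Domains in the universal cover of the punctured plane in polar coordinates \<open>(\<rho>, \<theta>)\<close>,
  with any part of the boundary allowed to belong to the domain.\<close>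

definition polar_domain :: "(real \<times> real) set \<Rightarrow> bool" where
  "polar_domain D \<longleftrightarrow>
     D \<subseteq> {0<..} \<times> UNIV \<and>
     (\<exists>U. open U \<and> connected U \<and> U \<noteq> {} \<and> U \<subseteq> D \<and> D \<subseteq> closure U)"

definition multivalued_graph :: "(real^3) set \<Rightarrow> bool" where
  "multivalued_graph G \<longleftrightarrow>
     (\<exists>D u. polar_domain D \<and> continuous_on D u \<and> smooth_on (interior D) u \<and>
        G = (\<lambda>(\<rho>, \<theta>). vector [\<rho> * cos \<theta>, \<rho> * sin \<theta>, u (\<rho>, \<theta>)]) ` D)"


section \<open>Segments, neighbourhoods and horizontal slices\<close>

definition x3_axis :: "(real^3) set" where
  "x3_axis = {p. p$1 = 0 \<and> p$2 = 0}"

definition x3_segment :: "real \<Rightarrow> real \<Rightarrow> (real^3) set" where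
  "x3_segment a b = {vector [0, 0, t] | t. a \<le> t \<and> t \<le> b}"

definition nbhd :: "real \<Rightarrow> (real^3) set \<Rightarrow> (real^3) set" where
  "nbhd \<delta> S = (\<Union>q\<in>S. ball q \<delta>)"

definition slice :: "(real^3) set \<Rightarrow> real \<Rightarrow> (real^3) set" where
  "slice M t = {p \<in> M. p$3 = t}"

definition is_arc :: "(real^3) set \<Rightarrow> bool" where
  "is_arc S \<longleftrightarrow> (\<exists>\<gamma>. arc \<gamma> \<and> path_image \<gamma> = S)"

text \<open>Both endpoints of an arc are obtained, since an arc can be traversed in either direction.\<close>

definition arc_endpoints :: "(real^3) set \<Rightarrow> (real^3) set" where
  "arc_endpoints S = {pathstart \<gamma> | \<gamma>. arc \<gamma> \<and> path_image \<gamma> = S}"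

end

theory Submission
  imports Defs "HOL-Complex_Analysis.Cauchy_Integral_Formula"
begin

text \<open>
  The disks are given by the Weierstrass representation with height differential \<open>dz\<close> and Gauss map
  \<open>e\<^bsup>ih\<^esup>\<close>, where \<open>h = u + iv\<close> is real on the real axis. The horizontal slice at height \<open>x\<close> is then
  the curve \<open>y \<mapsto> W(x + iy)\<close> with velocity \<open>-i cosh v e\<^bsup>iu\<^esup>\<close>; as long as \<open>u\<close> varies little along it, it is
  nearly straight, which gives embeddedness, and \<open>|A|\<^sup>2 = 2|h'|\<^sup>2 / cosh\<^sup>4 v\<close>. One takes \<open>h' = \<Lambda> p\<^sup>-\<^sup>3\<close>, where
  \<open>p = z + \<surd>(z\<^sup>2 + d\<^sup>2)\<close> smooths twice the positive part of \<open>x\<close> at scale \<open>d \<rightarrow> 0\<close>, on the domain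
  \<open>|y| \<le> c p(x)\<^sup>2\<close>. On the axis \<open>h'\<close> blows up exactly for \<open>x \<le> 0\<close>, while \<open>|u(x,y) - u(x,0)|\<close> is of
  order \<open>\<Lambda>c\<^sup>2\<close> and \<open>v\<close> reaches the size \<open>\<Lambda>c/p\<close>, so that the slice has radius about \<open>(p\<^sup>3/\<Lambda>) sinh (\<Lambda>c/p)\<close>.
  Away from the axis the curvature is bounded because \<open>|W|\<close> is comparable to \<open>sinh v / h'(x)\<close>.

  Each half \<open>\<plusminus>y > 0\<close> is a graph over the universal cover of the punctured plane, because on a curve
  \<open>|W| = const\<close> the polar angle of \<open>W\<close> is strictly increasing in \<open>x\<close>. Such a curve may leave the disk;
  it stays in the larger region \<open>|y| \<le> 8 c p(x)\<^sup>2\<close>, where the same estimates hold, since a decreasing function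
  of \<open>x\<close> separates the radii of the two regions.
\<close>

section \<open>Smooth functions\<close>

lemma Ck_on_cong:
  assumes "open S" "\<And>x. x \<in> S \<Longrightarrow> f x = g x"
  shows "Ck_on k S f \<longleftrightarrow> Ck_on k S g"
  using assms(2)
proof (induction k arbitrary: f g)
  case 0
  then show ?case
    by (simp cong: continuous_on_cong)
next
  case (Suc k)
  have "(f has_derivative D) (at x) \<longleftrightarrow> (g has_derivative D) (at x)" if "x \<in> S" for x D
    using has_derivative_transform_within_open[of f D x UNIV S g]
      has_derivative_transform_within_open[of g D x UNIV S f] Suc.prems \<open>open S\<close> that by auto
  then have "f differentiable (at x) \<longleftrightarrow> g differentiable (at x)"
    and "frechet_derivative f (at x) = frechet_derivative g (at x)" if "x \<in> S" for x
    using that by (simp_all add: differentiable_def frechet_derivative_def)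
  moreover from this have "Ck_on k S (\<lambda>x. frechet_derivative f (at x) v) \<longleftrightarrow> Ck_on k S (\<lambda>x. frechet_derivative g (at x) v)" for v
    by (intro Suc.IH) simp
  ultimately show ?case
    by simp
qed

text \<open>Induction on the order, for all members of the class at once: a directional derivative
  is again a member, so no formula for higher derivatives is needed. The smoothness claims below
  reduce to exhibiting such a class.\<close>

lemma Ck_on_of_closed_class:
  assumes "open S"
    and closed: "\<And>f. f \<in> \<F> \<Longrightarrow> \<exists>f'. (\<forall>x\<in>S. (f has_derivative f' x) (at x)) \<and> (\<forall>v. (\<lambda>x. f' x v) \<in> \<F>)"
    and "f \<in> \<F>"
  shows "Ck_on k S f"
  using \<open>f \<in> \<F>\<close>
proof (induction k arbitrary: f)
  case 0
  then obtain f' where "\<And>x. x \<in> S \<Longrightarrow> (f has_derivative f' x) (at x)"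
    using closed by blast
  then show ?case
    by (auto intro: continuous_at_imp_continuous_on has_derivative_continuous)
next
  case (Suc k)
  obtain f' where f': "\<And>x. x \<in> S \<Longrightarrow> (f has_derivative f' x) (at x)" "\<And>v. (\<lambda>x. f' x v) \<in> \<F>"
    using closed[OF Suc.prems] by blast
  have "Ck_on k S (\<lambda>x. frechet_derivative f (at x) v)" for v
  proof -
    have "frechet_derivative f (at x) v = f' x v" if "x \<in> S" for x
      using f'(1)[OF that] by (simp add: frechet_derivative_at[symmetric])
    then show ?thesis
      using Suc.IH[OF f'(2)[of v]] Ck_on_cong[OF \<open>open S\<close>, of "\<lambda>x. frechet_derivative f (at x) v" "\<lambda>x. f' x v"] by simp
  qed
  then show ?case
    using f'(1) by (auto simp: differentiable_def)
qed

lemma smooth_on_of_closed_class: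
  assumes "open S"
    and "\<And>f. f \<in> \<F> \<Longrightarrow> \<exists>f'. (\<forall>x\<in>S. (f has_derivative f' x) (at x)) \<and> (\<forall>v. (\<lambda>x. f' x v) \<in> \<F>)"
    and "f \<in> \<F>"
  shows "smooth_on S f"
  unfolding smooth_on_def using Ck_on_of_closed_class[OF assms] by blast

lemma smooth_on_subset: "smooth_on S f \<Longrightarrow> T \<subseteq> S \<Longrightarrow> smooth_on T f"
proof -
  have "Ck_on k T f" if "Ck_on k S f" "T \<subseteq> S" for k
    using that by (induction k arbitrary: f) (auto intro: continuous_on_subset)
  then show "smooth_on S f \<Longrightarrow> T \<subseteq> S \<Longrightarrow> smooth_on T f"
    by (simp add: smooth_on_def)
qed

section \<open>Inverse functions\<close>

text \<open>Invariance of domain makes the image open and the inverse continuous there; a left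
  inverse of the derivative at the single point \<open>z\<close> then determines the derivative of
  the inverse.\<close>

lemma has_derivative_inv_into:
  fixes f :: "'a::euclidean_space \<Rightarrow> 'b::euclidean_space"
  assumes "open S" "inj_on f S" "DIM('b) \<le> DIM('a)"
    and der: "\<And>x. x \<in> S \<Longrightarrow> (f has_derivative f' x) (at x)"
    and "z \<in> S" "bounded_linear g'" "g' \<circ> f' z = id"
  shows "(inv_into S f has_derivative g') (at (f z))"
proof -
  have cont: "continuous_on S f"
    using der by (meson continuous_at_imp_continuous_on has_derivative_continuous)
  have op: "open (f ` S)"
    using invariance_of_domain_gen[OF \<open>open S\<close> cont \<open>inj_on f S\<close> assms(3)] .
  have "continuous_on (f ` S) (inv_into S f)"
    using continuous_on_inverse_open[OF \<open>open S\<close> cont assms(3)] assms(2) by (simp add: inj_on_def)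
  then have "continuous (at (f z)) (inv_into S f)"
    using op \<open>z \<in> S\<close> by (simp add: continuous_on_eq_continuous_at)
  moreover have "inv_into S f (f z) = z"
    using assms by simp
  ultimately show ?thesis
    using has_derivative_inverse_basic[of f "f' z" "inv_into S f" "f z" g' "f ` S"] assms op der f_inv_into_f
    by (metis imageI)
qed

section \<open>The Weierstrass representation with height differential \<open>dz\<close>\<close>

lemma vec3_eq: "vector [a, b, c] = a *\<^sub>R axis 1 1 + b *\<^sub>R axis 2 1 + c *\<^sub>R (axis 3 1 :: real^3)"
  by (simp add: vec_eq_iff forall_3 axis_def vector_3)

text \<open>The real part of a holomorphic curve in complex three-space. Directional derivatives of
  such maps are again of this form, which is what makes them smooth.\<close>

definition re_surface :: "(complex \<Rightarrow> complex) \<Rightarrow> (complex \<Rightarrow> complex) \<Rightarrow> (complex \<Rightarrow> complex) \<Rightarrow> complex \<Rightarrow> real^3" where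
  "re_surface A B C z = vector [Re (A z), Re (B z), Re (C z)]"

lemma has_derivative_re_surface:
  assumes "(A has_field_derivative A') (at z)" "(B has_field_derivative B') (at z)"
    "(C has_field_derivative C') (at z)"
  shows "(re_surface A B C has_derivative (\<lambda>k. vector [Re (A' * k), Re (B' * k), Re (C' * k)])) (at z)"
  unfolding re_surface_def vec3_eq
  by (rule derivative_eq_intros refl assms[THEN has_field_derivative_imp_has_derivative])+

lemma smooth_on_re_surface:
  assumes S: "open S" and "A holomorphic_on S" "B holomorphic_on S" "C holomorphic_on S"
  shows "smooth_on S (re_surface A B C)"
proof (rule smooth_on_of_closed_class[OF S])
  let ?F = "{re_surface A B C | A B C. A holomorphic_on S \<and> B holomorphic_on S \<and> C holomorphic_on S}"
  show "re_surface A B C \<in> ?F"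
    using assms by blast
  fix f assume "f \<in> ?F"
  then obtain A B C where f: "f = re_surface A B C" and hol: "A holomorphic_on S" "B holomorphic_on S" "C holomorphic_on S"
    by blast
  let ?f' = "\<lambda>z k. vector [Re (deriv A z * k), Re (deriv B z * k), Re (deriv C z * k)] :: real^3"
  have "(f has_derivative ?f' z) (at z)" if "z \<in> S" for z
    unfolding f using that S hol by (intro has_derivative_re_surface) (auto intro: holomorphic_derivI)
  moreover have "(\<lambda>z. ?f' z v) \<in> ?F" for v
  proof -
    have "(\<lambda>z. ?f' z v) = re_surface (\<lambda>z. deriv A z * v) (\<lambda>z. deriv B z * v) (\<lambda>z. deriv C z * v)"
      by (simp add: re_surface_def fun_eq_iff)
    moreover have "(\<lambda>z. deriv A z * v) holomorphic_on S" "(\<lambda>z. deriv B z * v) holomorphic_on S"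
      "(\<lambda>z. deriv C z * v) holomorphic_on S"
      using S hol by (auto intro!: holomorphic_intros holomorphic_deriv)
    ultimately show ?thesis
      by (intro CollectI exI conjI)
  qed
  ultimately show "\<exists>f'. (\<forall>x\<in>S. (f has_derivative f' x) (at x)) \<and> (\<forall>v. (\<lambda>x. f' x v) \<in> ?F)"
    by (intro exI[of _ ?f'] conjI ballI allI)
qed

lemma coord_dir_simps [simp]: "coord_dir 1 = 1" "coord_dir 2 = \<i>"
  by (simp_all add: coord_dir_def)

lemma cross3_vector:
  "cross3 (vector [a1, a2, a3]) (vector [b1, b2, b3]) =
    vector [a2 * b3 - a3 * b2, a3 * b1 - a1 * b3, a1 * b2 - a2 * b1]"
  by (simp add: cross3_def vector_3)

lemma inner_vector3: "vector [a1, a2, a3] \<bullet> (vector [b1, b2, b3] :: real^3) = a1 * b1 + a2 * b2 + a3 * b3"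
  by (simp add: inner_vec_def sum_3 vector_3)

lemma scaleR_vector3: "c *\<^sub>R (vector [a1, a2, a3] :: real^3) = vector [c * a1, c * a2, c * a3]"
  by (simp add: vec_eq_iff forall_3 vector_3)

lemma Re_sin: "Re (sin h) = sin (Re h) * cosh (Im h)" and Im_sin: "Im (sin h) = cos (Re h) * sinh (Im h)"
  and Re_cos: "Re (cos h) = cos (Re h) * cosh (Im h)" and Im_cos: "Im (cos h) = - sin (Re h) * sinh (Im h)"
  by (simp_all add: Re_sin Im_sin Re_cos Im_cos cosh_field_def sinh_field_def field_simps)

text \<open>With Gauss map g = exp(ih) the Weierstrass integrand (1/g - g, i(1/g + g), 2)/2 becomes
  (-i sin h, i cos h, 1). \<open>G1\<close> and \<open>G2\<close> are primitives of the first two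
  entries; the third integrates to \<open>z\<close> itself.\<close>

locale weierstrass =
  fixes S :: "complex set" and h h' G1 G2 :: "complex \<Rightarrow> complex"
  assumes S: "open S"
    and h: "\<And>z. z \<in> S \<Longrightarrow> (h has_field_derivative h' z) (at z)"
    and G1: "\<And>z. z \<in> S \<Longrightarrow> (G1 has_field_derivative - \<i> * sin (h z)) (at z)"
    and G2: "\<And>z. z \<in> S \<Longrightarrow> (G2 has_field_derivative \<i> * cos (h z)) (at z)"
begin

abbreviation F :: "complex \<Rightarrow> real^3" where "F \<equiv> re_surface G1 G2 (\<lambda>z. z)"

lemma F_derivative:
  "z \<in> S \<Longrightarrow> (F has_derivative
    (\<lambda>k. vector [Re (- \<i> * sin (h z) * k), Re (\<i> * cos (h z) * k), Re (1 * k)])) (at z)"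
  by (intro has_derivative_re_surface G1 G2 DERIV_ident)

lemma smooth_on_F: "smooth_on S F"
proof (rule smooth_on_re_surface[OF S])
  show "G1 holomorphic_on S" "G2 holomorphic_on S" "(\<lambda>z. z) holomorphic_on S"
    using G1 G2 by (auto simp: holomorphic_on_def field_differentiable_def intro: has_field_derivative_at_within)
qed

lemma frechet_derivative_F:
  "z \<in> S \<Longrightarrow> frechet_derivative F (at z) =
    (\<lambda>k. vector [Re (- \<i> * sin (h z) * k), Re (\<i> * cos (h z) * k), Re k])"
  using F_derivative[THEN frechet_derivative_at] by simp

lemma pdiff_F:
  "z \<in> S \<Longrightarrow> pdiff i F z =
    re_surface (\<lambda>z. - \<i> * sin (h z) * coord_dir i) (\<lambda>z. \<i> * cos (h z) * coord_dir i) (\<lambda>z. coord_dir i) z"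
  by (simp add: pdiff_def frechet_derivative_F re_surface_def)

lemma pdiff_pdiff_F:
  assumes "z \<in> S"
  shows "pdiff i (pdiff j F) z = vector [Re (- \<i> * (cos (h z) * h' z) * coord_dir j * coord_dir i),
    Re (- \<i> * (sin (h z) * h' z) * coord_dir j * coord_dir i), 0]"
proof -
  let ?H = "re_surface (\<lambda>z. - \<i> * sin (h z) * coord_dir j) (\<lambda>z. \<i> * cos (h z) * coord_dir j) (\<lambda>z. coord_dir j)"
  have "(?H has_derivative (\<lambda>k. vector [Re (- \<i> * (cos (h z) * h' z) * coord_dir j * k),
    Re (- \<i> * (sin (h z) * h' z) * coord_dir j * k), Re (0 * k)])) (at z)"
    by (rule has_derivative_re_surface) (auto intro!: derivative_eq_intros h assms)
  then have "(pdiff j F has_derivative (\<lambda>k. vector [Re (- \<i> * (cos (h z) * h' z) * coord_dir j * k),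
    Re (- \<i> * (sin (h z) * h' z) * coord_dir j * k), Re (0 * k)])) (at z)"
    using S assms pdiff_F by (metis (no_types, lifting) has_derivative_transform_within_open)
  then show ?thesis
    unfolding pdiff_def[of i] by (simp add: frechet_derivative_at[symmetric])
qed

lemma first_fundamental_form_F:
  assumes "z \<in> S"
  shows "first_fundamental_form F z = mat ((cosh (Im (h z)))\<^sup>2)"
proof -
  define u v where "u = Re (h z)" and "v = Im (h z)"
  have 1: "(X * sin u)\<^sup>2 + (X * cos u)\<^sup>2 = X\<^sup>2" for X
    using sin_cos_squared_add[of u] by algebra
  show ?thesis
    unfolding first_fundamental_form_def vec_eq_iff forall_2
    using cosh_square_eq[of v] 1[of "sinh v"] 1[of "cosh v"]
    by (simp add: pdiff_F[OF assms] re_surface_def inner_vector3 mat_def Re_sin Im_sin Re_cos Im_cos algebra_simps power2_eq_square flip: u_def v_def)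
qed

lemma unit_normal_F:
  assumes "z \<in> S"
  shows "unit_normal F z =
    vector [cos (Re (h z)) / cosh (Im (h z)), sin (Re (h z)) / cosh (Im (h z)), - sinh (Im (h z)) / cosh (Im (h z))]"
proof -
  define u v where "u = Re (h z)" and "v = Im (h z)"
  have cs: "cos u * cos u = 1 - sin u * sin u" "cos u * (cos u * a) = a - sin u * (sin u * a)" for a
    using sin_cos_squared_add[of u] by algebra+
  have "cross3 (pdiff 1 F z) (pdiff 2 F z) = cosh v *\<^sub>R vector [cos u, sin u, - sinh v]"
    unfolding pdiff_F[OF assms] re_surface_def scaleR_vector3 cross3_vector
    by (simp add: vec_eq_iff forall_3 Re_sin Im_sin Re_cos Im_cos cs algebra_simps flip: u_def v_def)
  moreover have "norm (vector [cos u, sin u, - sinh v] :: real^3) = cosh v"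
  proof -
    have "vector [cos u, sin u, - sinh v] \<bullet> (vector [cos u, sin u, - sinh v] :: real^3) = (cosh v)\<^sup>2"
      unfolding inner_vector3 cosh_square_eq by (simp add: power2_eq_square[symmetric])
    then show ?thesis
      by (simp add: norm_eq_sqrt_inner)
  qed
  ultimately have "unit_normal F z = (cosh v *\<^sub>R vector [cos u, sin u, - sinh v]) /\<^sub>R (cosh v)\<^sup>2"
    by (simp add: unit_normal_def Let_def power2_eq_square)
  then show ?thesis
    by (simp add: scaleR_vector3 divide_simps power2_eq_square u_def v_def)
qed

text \<open>The metric is the scalar cosh^2 v, so its inverse is a division, and the second
  fundamental form is a trace-free symmetric matrix in Re h' and Im h'. Minimality and the formula
  for |A|^2 can both be read off.\<close>

lemma shape_operator_F:
  assumes "z \<in> S"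
  shows "shape_operator F z = (1 / (cosh (Im (h z)))\<^sup>2) *\<^sub>R
    vector [vector [Im (h' z), Re (h' z)], vector [Re (h' z), - Im (h' z)]]"
proof -
  define u v where "u = Re (h z)" and "v = Im (h z)"
  define c where "c = (cosh v)\<^sup>2"
  have "c \<noteq> 0"
    by (simp add: c_def)
  have inv: "matrix_inv (mat c :: real^2^2) = mat (1 / c)"
  proof -
    have "mat c ** mat (1 / c) = (mat 1 :: real^2^2)" "mat (1 / c) ** mat c = (mat 1 :: real^2^2)"
      using \<open>c \<noteq> 0\<close> by (auto simp: vec_eq_iff forall_2 mat_def matrix_matrix_mult_def sum_2)
    then show ?thesis
      unfolding matrix_inv_def
      by (intro some_equality) (auto, metis matrix_mul_assoc matrix_mul_lid matrix_mul_rid)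
  qed
  have cs: "cos u ^ 2 = 1 - sin u ^ 2"
    by (simp add: cos_squared_eq)
  have nz: "cosh v \<noteq> 0"
    by simp
  have "second_fundamental_form F z = vector [vector [Im (h' z), Re (h' z)], vector [Re (h' z), - Im (h' z)]]"
    unfolding second_fundamental_form_def vec_eq_iff forall_2 using cs nz
    by (simp add: pdiff_pdiff_F[OF assms] unit_normal_F[OF assms] inner_vector3 vector_2
        Re_sin Im_sin Re_cos Im_cos divide_simps u_def[symmetric] v_def[symmetric]) algebra
  then show ?thesis
    using \<open>c \<noteq> 0\<close>
    unfolding shape_operator_def first_fundamental_form_F[OF assms] v_def[symmetric] c_def[symmetric] inv
    by (simp add: vec_eq_iff forall_2 mat_def matrix_matrix_mult_def sum_2 vector_2)
qed

lemma mean_curvature_F: "z \<in> S \<Longrightarrow> mean_curvature F z = 0"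
  by (simp add: mean_curvature_def shape_operator_F trace_def sum_2 vector_2)

lemma sff_norm_sq_F: "z \<in> S \<Longrightarrow> sff_norm_sq F z = 2 * (norm (h' z))\<^sup>2 / (cosh (Im (h z))) ^ 4"
  unfolding sff_norm_sq_def cmod_power2
  by (simp add: shape_operator_F trace_def sum_2 vector_2 matrix_matrix_mult_def field_simps power2_eq_square power4_eq_xxxx)

lemma inj_frechet_derivative_F:
  assumes "z \<in> S"
  shows "inj (frechet_derivative F (at z))"
proof -
  have "linear (frechet_derivative F (at z))"
    using F_derivative[OF assms] has_derivative_linear frechet_derivative_at by fastforce
  moreover have "k = 0" if "frechet_derivative F (at z) k = 0" for k
  proof -
    have *: "Re (- \<i> * sin (h z) * k) = 0" "Re (\<i> * cos (h z) * k) = 0" "Re k = 0"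
      using that unfolding frechet_derivative_F[OF assms] by (auto simp: vec_eq_iff forall_3 vector_3)
    \<comment> \<open>The height component makes \<open>k\<close> imaginary; the other two
      components are then sin u cosh v and cos u cosh v times Im k.\<close>
    then have "sin (Re (h z)) * Im k = 0" "cos (Re (h z)) * Im k = 0"
      by (simp_all add: Re_sin Im_sin Re_cos Im_cos)
    then have "Im k = 0"
      using sin_zero_norm_cos_one[of "Re (h z)"] by auto
    with * show "k = 0"
      by (simp add: complex_eq_iff)
  qed
  ultimately show ?thesis
    using linear_injective_0 by blast
qed

end

section \<open>Helicoid-like surfaces: nearly straight slices turning about a vertical axis\<close>

text \<open>What the embedding and graph arguments use. \<open>f\<close> is the size of h' on a
  slice, \<open>Y\<close> the half-width of the disk, \<open>Ye\<close> that of the larger region,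
  and 1/2 bounds the turning along a slice. The non-increasing function \<open>T\<close> lies above
  every radius reached in the disk and below the radius at the rim of the larger region.
  \<open>h_cnj\<close> gives the half-turn symmetry about the axis.\<close>

locale helicoidal = weierstrass S h h' G1 G2
  for S :: "complex set" and h h' G1 G2 :: "complex \<Rightarrow> complex" +
  fixes f Y Y' Ye T :: "real \<Rightarrow> real"
  assumes connected_S: "connected S" and zero_in_S: "0 \<in> S"
    and cnj_S: "\<And>z. z \<in> S \<Longrightarrow> cnj z \<in> S"
    and h_cnj: "\<And>z. z \<in> S \<Longrightarrow> h (cnj z) = cnj (h z)"
    and G1_0: "G1 0 = 0" and G2_0: "G2 0 = 0"
    and region: "\<And>x y. \<bar>x\<bar> < 1 \<Longrightarrow> \<bar>y\<bar> \<le> Ye x \<Longrightarrow> Complex x y \<in> S"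
    and rotation: "\<And>x y. \<bar>x\<bar> < 1 \<Longrightarrow> \<bar>y\<bar> \<le> Ye x \<Longrightarrow> \<bar>Re (h (Complex x y)) - Re (h (Complex x 0))\<bar> \<le> 1/2"
    and h'_lower: "\<And>x y. \<bar>x\<bar> < 1 \<Longrightarrow> \<bar>y\<bar> \<le> Ye x \<Longrightarrow> f x / 2 \<le> Re (h' (Complex x y))"
    and h'_upper: "\<And>x y. \<bar>x\<bar> < 1 \<Longrightarrow> \<bar>y\<bar> \<le> Ye x \<Longrightarrow> norm (h' (Complex x y)) \<le> 2 * f x"
    and f_pos: "\<And>x. 0 < f x"
    and Y_pos: "\<And>x. 0 < Y x" and Y_less: "\<And>x. Y x < Ye x"
    and Y_deriv: "\<And>x. (Y has_real_derivative Y' x) (at x)" and Y'_cont: "continuous_on UNIV Y'"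
    and Ye_cont: "continuous_on UNIV Ye" and T_cont: "continuous_on UNIV T"
    and T_mono: "\<And>x x'. x \<le> x' \<Longrightarrow> T x' \<le> T x"
    and T_lower: "\<And>x. \<bar>x\<bar> < 1 \<Longrightarrow> 2 * sinh (2 * f x * Y x) / f x < T x"
    and T_upper: "\<And>x. \<bar>x\<bar> < 1 \<Longrightarrow> T x \<le> sinh (f x * Ye x / 2) / (4 * f x)"
begin

definition W :: "complex \<Rightarrow> complex" where
  "W z = Complex (Re (G1 z)) (Re (G2 z))"

abbreviation u :: "complex \<Rightarrow> real" where "u z \<equiv> Re (h z)"
abbreviation v :: "complex \<Rightarrow> real" where "v z \<equiv> Im (h z)"
abbreviation axis_angle :: "real \<Rightarrow> real" where "axis_angle x \<equiv> u (Complex x 0)"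

text \<open>The differential of the horizontal position \<open>W\<close> in the frame exp(iu), i
  exp(iu): sinh v per unit of x along the first vector, -cosh v per unit of y along the
  second.\<close>

definition dW :: "complex \<Rightarrow> complex \<Rightarrow> complex" where
  "dW z k = cis (u z) * Complex (sinh (v z) * Re k) (- cosh (v z) * Im k)"

text \<open>A slice leaves the axis with velocity -i exp(iu). This rotation turns that direction
  into the positive reals, so that every slice is close to a real segment.\<close>

definition Q :: "complex \<Rightarrow> complex" where
  "Q z = \<i> * cis (- axis_angle (Re z)) * W z"

lemma F_W: "F z = vector [Re (W z), Im (W z), Re z]"
  by (simp add: re_surface_def W_def)

lemma W_derivative:
  assumes "z \<in> S"
  shows "(W has_derivative dW z) (at z)"
proof -
  have W: "W = (\<lambda>z. of_real (Re (G1 z)) + \<i> * of_real (Re (G2 z)))"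
    by (simp add: W_def complex_eq_iff fun_eq_iff)
  have "(W has_derivative (\<lambda>k. of_real (Re (- \<i> * sin (h z) * k)) + \<i> * of_real (Re (\<i> * cos (h z) * k)))) (at z)"
    unfolding W by (rule derivative_eq_intros refl assms G1[THEN has_field_derivative_imp_has_derivative]
        G2[THEN has_field_derivative_imp_has_derivative])+
  also have "(\<lambda>k. of_real (Re (- \<i> * sin (h z) * k)) + \<i> * of_real (Re (\<i> * cos (h z) * k))) = dW z"
    by (simp add: dW_def complex_eq_iff fun_eq_iff Re_sin Im_sin Re_cos Im_cos algebra_simps)
  finally show ?thesis .
qed

text \<open>The sum of \<open>G\<close> and its reflection, the conjugate of
  \<open>G (cnj z)\<close>, has derivative zero on the connected set \<open>S\<close> and vanishes
  at 0.\<close>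

lemma odd_primitive:
  assumes G: "\<And>z. z \<in> S \<Longrightarrow> (G has_field_derivative g z) (at z)" "G 0 = 0"
    and g: "\<And>z. z \<in> S \<Longrightarrow> g (cnj z) = - cnj (g z)" and "z \<in> S"
  shows "G (cnj z) = - cnj (G z)"
proof -
  have "((\<lambda>z. G z + cnj (G (cnj z))) has_field_derivative 0) (at w)" if "w \<in> S" for w
  proof -
    have "(cnj \<circ> G \<circ> cnj has_field_derivative cnj (g (cnj w))) (at w)"
      by (rule has_field_derivative_cnj_cnj[OF G(1)[OF cnj_S[OF that]]])
    from DERIV_add[OF G(1)[OF that] this] show ?thesis
      using g[OF that] by (simp add: o_def)
  qed
  then have "(\<lambda>z. G z + cnj (G (cnj z))) constant_on S"
    using has_field_derivative_0_imp_constant_on connected_S S by blast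
  then have "G z + cnj (G (cnj z)) = G 0 + cnj (G (cnj 0))"
    using \<open>z \<in> S\<close> zero_in_S unfolding constant_on_def by metis
  then have "cnj (G (cnj z)) = - G z"
    using G(2) by (simp add: add_eq_0_iff)
  then show ?thesis
    by (metis complex_cnj_cnj complex_cnj_minus)
qed

text \<open>The half-turn of the surface about the axis. At real points it forces \<open>W\<close>
  to vanish, so the axis lies in the surface.\<close>

lemma W_cnj:
  assumes "z \<in> S"
  shows "W (cnj z) = - W z"
proof -
  have "G1 (cnj z) = - cnj (G1 z)" "G2 (cnj z) = - cnj (G2 z)"
    by (rule odd_primitive[OF G1 G1_0 _ assms] odd_primitive[OF G2 G2_0 _ assms];
        simp add: h_cnj complex_eq_iff Re_sin Im_sin Re_cos Im_cos)+
  then show ?thesis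
    by (simp add: W_def complex_eq_iff)
qed

lemma Ye_pos: "0 < Ye x"
  using Y_pos[of x] Y_less[of x] by simp

lemma axis_in_S: "\<bar>x\<bar> < 1 \<Longrightarrow> Complex x 0 \<in> S"
  using region[of x 0] Ye_pos[of x] by simp

lemma W_axis: "\<bar>x\<bar> < 1 \<Longrightarrow> W (Complex x 0) = 0"
  using W_cnj[OF axis_in_S, of x] by (simp add: complex_cnj complex_eq_iff)

lemma v_axis: "\<bar>x\<bar> < 1 \<Longrightarrow> v (Complex x 0) = 0"
  using h_cnj[OF axis_in_S, of x] by (simp add: complex_cnj complex_eq_iff)

lemma F_axis: "\<bar>x\<bar> < 1 \<Longrightarrow> F (Complex x 0) = vector [0, 0, x]"
  by (simp add: F_W W_axis)

lemma vertical_line: "(Complex x has_derivative (\<lambda>k. k *\<^sub>R \<i>)) (at y)"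
proof -
  have "Complex x = (\<lambda>y. of_real x + of_real y * \<i>)"
    by (simp add: fun_eq_iff complex_eq_iff)
  then show ?thesis
    by (auto intro!: derivative_eq_intros simp: scaleR_conv_of_real)
qed

lemma v_vertical:
  assumes "Complex x y \<in> S"
  shows "((\<lambda>y. v (Complex x y)) has_real_derivative Re (h' (Complex x y))) (at y)"
  using has_derivative_Im[OF has_derivative_compose[OF vertical_line[of x y]
        has_field_derivative_imp_has_derivative[OF h[OF assms]]]]
  by (simp add: has_field_derivative_def scaleR_conv_of_real algebra_simps mult_commute_abs)

lemma Q_vertical:
  assumes "Complex x y \<in> S"
  shows "((\<lambda>y. Q (Complex x y)) has_vector_derivative
    cosh (v (Complex x y)) *\<^sub>R cis (u (Complex x y) - axis_angle x)) (at y)"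
proof -
  have "((\<lambda>y. \<i> * cis (- axis_angle x) * W (Complex x y)) has_derivative
      (\<lambda>k. \<i> * cis (- axis_angle x) * dW (Complex x y) (k *\<^sub>R \<i>))) (at y)"
    by (intro has_derivative_mult_right has_derivative_compose[OF vertical_line W_derivative[OF assms]])
  moreover have "\<i> * cis (- axis_angle x) * dW (Complex x y) (k *\<^sub>R \<i>) =
      k *\<^sub>R cosh (v (Complex x y)) *\<^sub>R cis (u (Complex x y) - axis_angle x)" for k
  proof -
    have "cis (u (Complex x y) - axis_angle x) = cis (- axis_angle x) * cis (u (Complex x y))"
      by (simp add: cis_mult)
    moreover have "Complex 0 (- (cosh (v (Complex x y)) * k)) = - (k * cosh (v (Complex x y))) * \<i>"
      by (simp add: complex_eq_iff)
    moreover have "a * \<i> * (\<i> * b) = - (a * b)" for a b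
      by (simp add: algebra_simps flip: power2_eq_square)
    ultimately show ?thesis
      by (simp add: dW_def scaleR_conv_of_real algebra_simps)
  qed
  ultimately show ?thesis
    by (simp add: has_vector_derivative_def Q_def)
qed

lemma norm_Q [simp]: "norm (Q z) = norm (W z)"
  by (simp add: Q_def norm_mult)

text \<open>A turning of at most 1/2 radian keeps the velocity of \<open>Q\<close> strictly inside
  the 45 degree cone about the positive reals.\<close>

lemma trig_half:
  assumes "\<bar>t::real\<bar> \<le> 1/2"
  shows "1/2 < cos t" "\<bar>sin t\<bar> < cos t"
proof -
  have s: "\<bar>sin s\<bar> \<le> \<bar>s\<bar>" for s :: real
    by (rule abs_sin_x_le_abs_x)
  have "cos t = 1 - 2 * (sin (t/2))\<^sup>2"
    using cos_double_sin[of "t/2"] by simp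
  moreover have "(sin (t/2))\<^sup>2 \<le> (1/4)\<^sup>2"
    using s[of "t/2"] assms by (intro power2_le_iff_abs_le[THEN iffD2]) auto
  ultimately have c: "7/8 \<le> cos t"
    by (simp add: power2_eq_square)
  then show "1/2 < cos t"
    by simp
  show "\<bar>sin t\<bar> < cos t"
    using s[of t] assms c by linarith
qed

section \<open>Estimates along a single horizontal slice\<close>

context
  fixes x :: real
  assumes x: "\<bar>x\<bar> < 1"
begin

lemma vertical_in_S: "\<bar>y\<bar> \<le> Ye x \<Longrightarrow> Complex x y \<in> S"
  using region x by blast

lemma v_bounds:
  assumes "0 \<le> y" "y \<le> Ye x"
  shows "f x * y / 2 \<le> v (Complex x y)" "v (Complex x y) \<le> 2 * f x * y"
proof -
  have d: "((\<lambda>y. v (Complex x y)) has_real_derivative Re (h' (Complex x t))) (at t)" if "0 \<le> t" "t \<le> y" for t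
    using that assms by (intro v_vertical vertical_in_S) auto
  have "v (Complex x 0) - f x * 0 / 2 \<le> v (Complex x y) - f x * y / 2"
  proof (rule DERIV_nonneg_imp_nondecreasing[OF assms(1)])
    fix t assume t: "0 \<le> t" "t \<le> y"
    show "\<exists>D. ((\<lambda>y. v (Complex x y) - f x * y / 2) has_real_derivative D) (at t) \<and> 0 \<le> D"
      using t assms h'_lower[OF x, of t] DERIV_diff[OF d[OF t] DERIV_cmult[OF DERIV_ident], of "f x / 2"]
      by (intro exI[of _ "Re (h' (Complex x t)) - f x / 2"]) simp
  qed
  then show "f x * y / 2 \<le> v (Complex x y)"
    using v_axis[OF x] by simp
  have "2 * f x * 0 - v (Complex x 0) \<le> 2 * f x * y - v (Complex x y)"
  proof (rule DERIV_nonneg_imp_nondecreasing[OF assms(1)])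
    fix t assume t: "0 \<le> t" "t \<le> y"
    show "\<exists>D. ((\<lambda>y. 2 * f x * y - v (Complex x y)) has_real_derivative D) (at t) \<and> 0 \<le> D"
      using t assms h'_upper[OF x, of t] complex_Re_le_cmod[of "h' (Complex x t)"]
        DERIV_diff[OF DERIV_cmult[OF DERIV_ident] d[OF t], of "2 * f x"]
      by (intro exI[of _ "2 * f x - Re (h' (Complex x t))"]) simp
  qed
  then show "v (Complex x y) \<le> 2 * f x * y"
    using v_axis[OF x] by simp
qed

lemma v_pos: "0 < y \<Longrightarrow> y \<le> Ye x \<Longrightarrow> 0 < v (Complex x y)"
  using v_bounds(1)[of y] f_pos[of x] by (smt (verit) mult_pos_pos divide_pos_pos)

lemma angle_bounds:
  assumes "\<bar>y\<bar> \<le> Ye x"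
  shows "1/2 < cos (u (Complex x y) - axis_angle x)"
    "\<bar>sin (u (Complex x y) - axis_angle x)\<bar> < cos (u (Complex x y) - axis_angle x)"
  using trig_half[OF rotation[OF x assms]] by auto

lemma Q_derivs:
  assumes "\<bar>y\<bar> \<le> Ye x"
  shows "((\<lambda>y. Re (Q (Complex x y))) has_real_derivative
      cosh (v (Complex x y)) * cos (u (Complex x y) - axis_angle x)) (at y)"
    "((\<lambda>y. Im (Q (Complex x y))) has_real_derivative
      cosh (v (Complex x y)) * sin (u (Complex x y) - axis_angle x)) (at y)"
  unfolding has_field_derivative_def
  by (rule has_derivative_eq_rhs[OF has_derivative_Re[OF Q_vertical[OF vertical_in_S[OF assms], unfolded has_vector_derivative_def]]]
      has_derivative_eq_rhs[OF has_derivative_Im[OF Q_vertical[OF vertical_in_S[OF assms], unfolded has_vector_derivative_def]]];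
      simp add: fun_eq_iff)+

text \<open>The velocity of \<open>Q\<close> has positive real part. This is the source of
  embeddedness: two points of one slice never coincide.\<close>

lemma Re_Q_less:
  assumes "- Ye x \<le> y1" "y1 < y2" "y2 \<le> Ye x"
  shows "Re (Q (Complex x y1)) < Re (Q (Complex x y2))"
proof (rule DERIV_pos_imp_increasing[OF assms(2)])
  fix t assume "y1 \<le> t" "t \<le> y2"
  then have "\<bar>t\<bar> \<le> Ye x"
    using assms by auto
  from Q_derivs(1)[OF this] angle_bounds[OF this]
  show "\<exists>D. ((\<lambda>y. Re (Q (Complex x y))) has_real_derivative D) (at t) \<and> 0 < D"
    by (intro exI conjI) auto
qed

lemma Q_axis: "Q (Complex x 0) = 0"
  by (simp add: Q_def W_axis[OF x])

lemma Re_Q_pos: "0 < y \<Longrightarrow> y \<le> Ye x \<Longrightarrow> 0 < Re (Q (Complex x y))"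
  using Re_Q_less[of 0 y] Ye_pos[of x] Q_axis by simp

text \<open>The velocity lies in the convex cone |Im| \<le> Re, so integrating it from
  \<open>Q\<close> = 0 keeps the position in that cone. The two sides of the cone are the cases s =
  1 and s = -1.\<close>

lemma Im_Q_le:
  assumes "0 \<le> y" "y \<le> Ye x"
  shows "\<bar>Im (Q (Complex x y))\<bar> \<le> Re (Q (Complex x y))"
proof -
  have "Re (Q (Complex x 0)) - s * Im (Q (Complex x 0)) \<le> Re (Q (Complex x y)) - s * Im (Q (Complex x y))"
    if "\<bar>s\<bar> = 1" for s
  proof (rule DERIV_nonneg_imp_nondecreasing[OF assms(1)])
    fix t assume t: "0 \<le> t" "t \<le> y"
    then have t': "\<bar>t\<bar> \<le> Ye x"
      using assms by auto
    let ?a = "u (Complex x t) - axis_angle x"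
    have "s * sin ?a \<le> cos ?a"
      using angle_bounds(2)[OF t'] that by (auto simp: abs_if split: if_splits)
    then have "0 \<le> cosh (v (Complex x t)) * (cos ?a - s * sin ?a)"
      by simp
    then show "\<exists>D. ((\<lambda>y. Re (Q (Complex x y)) - s * Im (Q (Complex x y))) has_real_derivative D) (at t) \<and> 0 \<le> D"
      using DERIV_diff[OF Q_derivs(1)[OF t'] DERIV_cmult[OF Q_derivs(2)[OF t'], of s]]
      by (intro exI conjI) (auto simp: algebra_simps)
  qed
  from this[of 1] this[of "-1"] show ?thesis
    by (simp add: Q_axis)
qed

text \<open>Position and velocity both lie within 45 degrees of the positive reals, the velocity
  strictly, so their inner product, half the derivative of |W|^2, is positive.\<close>

lemma norm_W_less:
  assumes "0 \<le> y1" "y1 < y2" "y2 \<le> Ye x"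
  shows "norm (W (Complex x y1)) < norm (W (Complex x y2))"
proof -
  have sq: "(norm (W z))\<^sup>2 = Re (Q z) * Re (Q z) + Im (Q z) * Im (Q z)" for z
    unfolding norm_Q[symmetric] cmod_power2 by (simp add: power2_eq_square)
  let ?g = "\<lambda>y. Re (Q (Complex x y)) * Re (Q (Complex x y)) + Im (Q (Complex x y)) * Im (Q (Complex x y))"
  have "?g y1 < ?g y2"
  \<comment> \<open>For y1 = 0 the derivative vanishes at the left end, on the axis; hence the
    version that tests interior points only.\<close>
  proof (rule DERIV_pos_imp_increasing_open[OF assms(2)])
    fix t assume t: "y1 < t" "t < y2"
    then have t': "\<bar>t\<bar> \<le> Ye x"
      using assms by auto
    let ?a = "u (Complex x t) - axis_angle x" and ?R = "Re (Q (Complex x t))" and ?I = "Im (Q (Complex x t))"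
    have "\<bar>?I * sin ?a\<bar> < ?R * cos ?a"
    proof -
      have "\<bar>?I * sin ?a\<bar> \<le> ?R * \<bar>sin ?a\<bar>"
        unfolding abs_mult using Im_Q_le[of t] t assms by (intro mult_right_mono) auto
      also have "\<dots> < ?R * cos ?a"
        using angle_bounds(2)[OF t'] Re_Q_pos[of t] t assms by (intro mult_strict_left_mono) auto
      finally show ?thesis .
    qed
    then have "0 < 2 * cosh (v (Complex x t)) * (?R * cos ?a + ?I * sin ?a)"
      by (intro mult_pos_pos) auto
    then show "\<exists>D. (?g has_real_derivative D) (at t) \<and> 0 < D"
      using DERIV_add[OF DERIV_mult[OF Q_derivs(1)[OF t'] Q_derivs(1)[OF t']]
          DERIV_mult[OF Q_derivs(2)[OF t'] Q_derivs(2)[OF t']]]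
      by (intro exI conjI) (auto simp: algebra_simps)
  next
    show "continuous_on {y1..y2} ?g"
      using assms by (intro continuous_at_imp_continuous_on ballI continuous_intros DERIV_isCont[OF Q_derivs(1)]
          DERIV_isCont[OF Q_derivs(2)]) auto
  qed
  then have "(norm (W (Complex x y1)))\<^sup>2 < (norm (W (Complex x y2)))\<^sup>2"
    unfolding sq .
  then show ?thesis
    by (rule power2_less_imp_less) simp
qed

text \<open>Re Q grows at a rate above cosh v / 2, whereas sinh v / (4 f) grows at most at that rate
  because Re h' \<le> 2 f.\<close>

lemma norm_W_lower:
  assumes "0 \<le> y" "y \<le> Ye x"
  shows "sinh (f x * y / 2) / (4 * f x) \<le> norm (W (Complex x y))"
proof -
  let ?g = "\<lambda>y. Re (Q (Complex x y)) - sinh (v (Complex x y)) / (4 * f x)"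
  have "?g 0 \<le> ?g y"
  proof (rule DERIV_nonneg_imp_nondecreasing[OF assms(1)])
    fix t assume t: "0 \<le> t" "t \<le> y"
    then have t': "\<bar>t\<bar> \<le> Ye x"
      using assms by auto
    let ?a = "u (Complex x t) - axis_angle x"
    let ?D = "cosh (v (Complex x t)) * (cos ?a - Re (h' (Complex x t)) / (4 * f x))"
    have "Re (h' (Complex x t)) \<le> 2 * f x"
      using h'_upper[OF x t'] complex_Re_le_cmod order_trans by blast
    then have "Re (h' (Complex x t)) / (4 * f x) \<le> 1/2"
      using f_pos[of x] by (simp add: field_simps)
    then have "0 \<le> ?D"
      using angle_bounds(1)[OF t'] by simp
    moreover have "(?g has_real_derivative ?D) (at t)"
      using DERIV_diff[OF Q_derivs(1)[OF t']
          DERIV_cdivide[OF has_field_derivative_sinh[OF v_vertical[OF vertical_in_S[OF t']]], of "4 * f x"]]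
      by (simp add: algebra_simps)
    ultimately show "\<exists>D. (?g has_real_derivative D) (at t) \<and> 0 \<le> D"
      by blast
  qed
  then have "sinh (v (Complex x y)) / (4 * f x) \<le> Re (Q (Complex x y))"
    using Q_axis v_axis[OF x] by simp
  also have "\<dots> \<le> norm (W (Complex x y))"
    using complex_Re_le_cmod[of "Q (Complex x y)"] by simp
  moreover have "sinh (f x * y / 2) \<le> sinh (v (Complex x y))"
    using v_bounds(1)[OF assms] by simp
  then have "sinh (f x * y / 2) / (4 * f x) \<le> sinh (v (Complex x y)) / (4 * f x)"
    using f_pos[of x] by (simp add: divide_right_mono)
  ultimately show ?thesis
    by linarith
qed

text \<open>The speed of \<open>Q\<close> is cosh v, and Re h' \<ge> f / 2 bounds it by the
  derivative of 2 sinh v / f.\<close>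

lemma norm_W_upper:
  assumes "0 \<le> y" "y \<le> Ye x"
  shows "norm (W (Complex x y)) \<le> 2 * sinh (v (Complex x y)) / f x"
proof (cases "y = 0")
  case True
  then show ?thesis
    by (simp add: W_axis[OF x] v_axis[OF x])
next
  case False
  let ?\<phi> = "\<lambda>y. 2 * sinh (v (Complex x y)) / f x"
  let ?\<phi>' = "\<lambda>t. 2 * cosh (v (Complex x t)) * Re (h' (Complex x t)) / f x"
  have \<phi>: "(?\<phi> has_real_derivative ?\<phi>' t) (at t)" if "\<bar>t\<bar> \<le> Ye x" for t
    using DERIV_cdivide[OF DERIV_cmult[OF has_field_derivative_sinh[OF v_vertical[OF vertical_in_S[OF that]]], of 2], of "f x"]
    by (simp add: algebra_simps)
  have "norm (Q (Complex x y) - Q (Complex x 0)) \<le> ?\<phi> y - ?\<phi> 0"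
  proof (rule differentiable_bound_general[where f = "\<lambda>y. Q (Complex x y)"
        and f' = "\<lambda>t. cosh (v (Complex x t)) *\<^sub>R cis (u (Complex x t) - axis_angle x)" and \<phi>' = ?\<phi>'])
    show "0 < y"
      using assms False by simp
    fix t assume "0 < t" "t < y"
    then have t: "\<bar>t\<bar> \<le> Ye x"
      using assms by auto
    show "((\<lambda>y. Q (Complex x y)) has_vector_derivative
        cosh (v (Complex x t)) *\<^sub>R cis (u (Complex x t) - axis_angle x)) (at t)"
      by (rule Q_vertical[OF vertical_in_S[OF t]])
    show "(?\<phi> has_vector_derivative ?\<phi>' t) (at t)"
      using \<phi>[OF t] by (simp add: has_real_derivative_iff_has_vector_derivative)
    have "1 \<le> 2 * Re (h' (Complex x t)) / f x"
      using h'_lower[OF x t] f_pos[of x] by (simp add: field_simps)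
    then have "cosh (v (Complex x t)) * 1 \<le> cosh (v (Complex x t)) * (2 * Re (h' (Complex x t)) / f x)"
      by (intro mult_left_mono) auto
    then show "norm (cosh (v (Complex x t)) *\<^sub>R cis (u (Complex x t) - axis_angle x)) \<le> ?\<phi>' t"
      by (simp add: algebra_simps)
  next
    show "continuous_on {0..y} (\<lambda>y. Q (Complex x y))"
      using assms by (intro continuous_at_imp_continuous_on ballI
          has_vector_derivative_continuous[OF Q_vertical[OF vertical_in_S]]) auto
    show "continuous_on {0..y} ?\<phi>"
      using assms by (intro continuous_at_imp_continuous_on ballI DERIV_isCont[OF \<phi>]) auto
  qed
  then show ?thesis
    by (simp add: Q_axis v_axis[OF x])
qed

end

end

text \<open>Near \<open>z\<close>, where continuity keeps the change of the imaginary part below pi,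
  a continuous logarithm of c W is a constant plus the principal logarithm of W w / W z. The factor
  \<open>c\<close> cancels in the quotient.\<close>

lemma has_derivative_of_log_lift:
  fixes \<kappa> W :: "complex \<Rightarrow> complex"
  assumes "open H" "z \<in> H" "continuous_on H \<kappa>"
    and exp: "\<And>w. w \<in> H \<Longrightarrow> exp (\<kappa> w) = c * W w"
    and W: "(W has_derivative D) (at z)"
  shows "(\<kappa> has_derivative (\<lambda>k. D k / W z)) (at z)"
proof -
  have nz: "c \<noteq> 0" "W z \<noteq> 0"
    using exp[OF \<open>z \<in> H\<close>] by (auto simp: exp_not_eq_zero dest: sym)
  have "isCont \<kappa> z"
    using assms by (simp add: continuous_on_eq_continuous_at)
  then obtain d where d: "d > 0" "\<And>w. dist w z < d \<Longrightarrow> dist (\<kappa> w) (\<kappa> z) < pi"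
    using pi_gt_zero unfolding continuous_at_eps_delta by blast
  have eq: "\<kappa> z + Ln (W w / W z) = \<kappa> w" if "w \<in> H \<inter> ball z d" for w
  proof -
    have "\<bar>Im (\<kappa> w - \<kappa> z)\<bar> < pi"
      using d(2)[of w] that abs_Im_le_cmod[of "\<kappa> w - \<kappa> z"] by (auto simp: dist_norm norm_minus_commute)
    then have "Ln (exp (\<kappa> w - \<kappa> z)) = \<kappa> w - \<kappa> z"
      by (intro Ln_exp) auto
    moreover have "exp (\<kappa> w - \<kappa> z) = W w / W z"
      using that exp \<open>z \<in> H\<close> nz by (simp add: exp_diff)
    ultimately show ?thesis
      by simp
  qed
  have "(Ln has_derivative (*) (inverse 1)) (at (W z / W z))"
    using has_field_derivative_Ln[of 1] nz by (simp add: has_field_derivative_def)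
  from has_derivative_compose[OF has_derivative_divide'[OF W has_derivative_const, of "W z"] this]
  have "((\<lambda>w. \<kappa> z + Ln (W w / W z)) has_derivative (\<lambda>k. D k / W z)) (at z)"
    using nz by (auto intro!: derivative_eq_intros simp: divide_simps)
  moreover have "open (H \<inter> ball z d)" "z \<in> H \<inter> ball z d"
    using assms d by auto
  ultimately show ?thesis
    using eq by (rule has_derivative_transform_within_open)
qed

section \<open>Polar coordinates of the horizontal position on the half y > 0\<close>

context helicoidal
begin

definition half_plane :: "complex set" where
  "half_plane = {z. \<bar>Re z\<bar> < 1 \<and> 0 < Im z \<and> Im z < Ye (Re z)}"

lemma half_plane_in_S: "z \<in> half_plane \<Longrightarrow> z \<in> S"
  using region[of "Re z" "Im z"] by (simp add: half_plane_def)

lemma open_half_plane: "open half_plane"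
proof -
  have "continuous_on UNIV (\<lambda>z. Ye (Re z))"
    by (intro continuous_on_compose2[OF Ye_cont] continuous_intros) auto
  then show ?thesis
    unfolding half_plane_def by (intro open_Collect_conj open_Collect_less continuous_intros) auto
qed

lemma half_plane_Q:
  assumes "z \<in> half_plane"
  shows "0 < Re (Q z)" "\<bar>Im (Q z)\<bar> \<le> Re (Q z)"
  using Re_Q_pos[of "Re z" "Im z"] Im_Q_le[of "Re z" "Im z"] assms by (simp_all add: half_plane_def)

lemma W_nz: "z \<in> half_plane \<Longrightarrow> W z \<noteq> 0"
  using half_plane_Q(1)[of z] by (auto simp: Q_def)

lemma v_half_plane_pos: "z \<in> half_plane \<Longrightarrow> 0 < v z"
  using v_pos[of "Re z" "Im z"] by (simp add: half_plane_def)

text \<open>The position vector always lies on the same side of the normal \<open>e\<^bsup>iu\<^esup>\<close>; this is the sign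
  that makes the polar radius increase with \<open>y\<close> and the polar angle increase with \<open>x\<close>.\<close>

lemma Im_normal_W:
  assumes "z \<in> half_plane"
  shows "Im (cis (- u z) * W z) < 0"
proof -
  let ?a = "u z - axis_angle (Re z)"
  have zc: "Complex (Re z) (Im z) = z" and x: "\<bar>Re z\<bar> < 1" and y: "\<bar>Im z\<bar> \<le> Ye (Re z)"
    using assms by (auto simp: half_plane_def)
  have a: "\<bar>sin ?a\<bar> < cos ?a"
    using angle_bounds(2)[OF x y] by (simp add: zc)
  have "\<bar>Im (Q z) * sin ?a\<bar> \<le> Re (Q z) * \<bar>sin ?a\<bar>"
    unfolding abs_mult using half_plane_Q[OF assms] by (intro mult_right_mono) auto
  also have "\<dots> < Re (Q z) * cos ?a"
    using half_plane_Q[OF assms] a by (intro mult_strict_left_mono) auto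
  finally have "0 < Re (Q z) * cos ?a + Im (Q z) * sin ?a"
    by linarith
  also have "\<dots> = Re (cis (- ?a) * Q z)"
    unfolding times_complex.sel cis.sel cos_minus sin_minus by (simp add: algebra_simps)
  also have "cis (- ?a) * Q z = \<i> * (cis (- ?a) * cis (- axis_angle (Re z)) * W z)"
    by (simp add: Q_def)
  also have "cis (- ?a) * cis (- axis_angle (Re z)) = cis (- u z)"
    by (simp add: cis_mult)
  finally show ?thesis
    by simp
qed

text \<open>The offset \<open>c\<close> of the polar angle is \<open>0\<close> for the half \<open>y > 0\<close> of the surface and \<open>\<pi>\<close> for
  the other half, which is its rotation about the axis.\<close>

definition polar_log :: "real \<Rightarrow> complex \<Rightarrow> complex" where
  "polar_log c z = Ln (Q z) + \<i> * of_real (axis_angle (Re z) - pi/2 + c)"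

definition polar :: "real \<Rightarrow> complex \<Rightarrow> real \<times> real" where
  "polar c z = (exp (Re (polar_log c z)), Im (polar_log c z))"

lemma exp_polar_log:
  assumes "z \<in> half_plane"
  shows "exp (polar_log c z) = cis c * W z"
proof -
  have "Q z \<noteq> 0"
    using half_plane_Q(1)[OF assms] by auto
  then have "exp (polar_log c z) = Q z * cis (axis_angle (Re z) - pi/2 + c)"
    by (simp add: polar_log_def exp_add cis_conv_exp)
  also have "\<dots> = \<i> * (cis (- axis_angle (Re z)) * cis (axis_angle (Re z) - pi/2 + c)) * W z"
    by (simp add: Q_def)
  also have "cis (- axis_angle (Re z)) * cis (axis_angle (Re z) - pi/2 + c) = - \<i> * cis c"
    by (simp add: complex_eq_iff cos_diff sin_diff cis_mult)
  finally show ?thesis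
    by simp
qed

lemma fst_polar: "z \<in> half_plane \<Longrightarrow> fst (polar c z) = norm (W z)"
  using exp_polar_log[of z c] norm_exp_eq_Re[of "polar_log c z"] by (simp add: polar_def norm_mult)

lemma W_polar:
  assumes "z \<in> half_plane"
  shows "cis c * W z = fst (polar c z) *\<^sub>R cis (snd (polar c z))"
  using exp_polar_log[OF assms, of c] exp_eq_polar[of "polar_log c z"]
  by (simp add: polar_def scaleR_conv_of_real exp_of_real)

text \<open>\<open>Q\<close> stays in the right half-plane, so the principal logarithm meets no
  branch cut. The unlimited winding about the axis is carried by \<open>axis_angle\<close>
  alone.\<close>

lemma continuous_on_polar_log: "continuous_on half_plane (polar_log c)"
proof -
  have h: "continuous_on S h"
    using h by (auto intro!: continuous_at_imp_continuous_on DERIV_isCont)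
  have W: "continuous_on half_plane W"
    using W_derivative half_plane_in_S
    by (auto intro!: continuous_at_imp_continuous_on intro: has_derivative_continuous)
  have "continuous_on half_plane (\<lambda>z. h (Complex (Re z) 0))"
  proof (rule continuous_on_compose2[OF h])
    have "(\<lambda>z. Complex (Re z) 0) = (\<lambda>z. of_real (Re z))"
      by (simp add: fun_eq_iff complex_eq_iff)
    then show "continuous_on half_plane (\<lambda>z. Complex (Re z) 0)"
      by (auto intro!: continuous_intros)
    show "(\<lambda>z. Complex (Re z) 0) ` half_plane \<subseteq> S"
      using axis_in_S by (auto simp: half_plane_def)
  qed
  then have a: "continuous_on half_plane (\<lambda>z. axis_angle (Re z))"
    by (intro continuous_intros)
  have Q: "continuous_on half_plane Q"
    unfolding Q_def cis_conv_exp
    by (intro continuous_on_mult continuous_on_exp continuous_on_const continuous_on_of_real continuous_on_minus a W)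
  show ?thesis
    unfolding polar_log_def
    by (intro continuous_on_add continuous_on_mult continuous_on_const continuous_on_of_real continuous_on_diff
        continuous_on_Ln' a Q) (use half_plane_Q(1) in \<open>force simp: complex_nonpos_Reals_iff\<close>)
qed

lemma polar_log_derivative:
  assumes "z \<in> half_plane"
  shows "(polar_log c has_derivative (\<lambda>k. dW z k / W z)) (at z)"
  using has_derivative_of_log_lift[OF open_half_plane assms continuous_on_polar_log exp_polar_log
      W_derivative[OF half_plane_in_S[OF assms]]] .

subsection \<open>Injectivity of polar coordinates\<close>

text \<open>The coordinates x and ln |W|. In them a curve |W| = const has constant imaginary part
  and can be followed in x.\<close>

definition level_map :: "complex \<Rightarrow> complex" where
  "level_map z = Complex (Re z) (Re (polar_log 0 z))"

lemma norm_W_exp: "z \<in> half_plane \<Longrightarrow> norm (W z) = exp (Re (polar_log 0 z))"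
  using fst_polar[of z 0] by (simp add: polar_def)

lemma inj_on_level_map: "inj_on level_map half_plane"
proof (rule inj_onI)
  fix z w assume z: "z \<in> half_plane" and w: "w \<in> half_plane" and eq: "level_map z = level_map w"
  have W: "norm (W z) = norm (W w)" and Re: "Re z = Re w"
    using eq by (simp_all add: norm_W_exp[OF z] norm_W_exp[OF w] level_map_def)
  have zw: "Complex (Re w) (Im z) = z" "Complex (Re w) (Im w) = w"
    using Re by (simp_all add: complex_eq_iff)
  have "\<not> Im z < Im w" "\<not> Im w < Im z"
    using norm_W_less[of "Re w" "Im z" "Im w"] norm_W_less[of "Re w" "Im w" "Im z"] z w W Re
    unfolding zw by (auto simp: half_plane_def)
  with Re show "z = w"
    by (simp add: complex_eq_iff)
qed

text \<open>By \<open>Im_normal_W\<close> the y-derivative \<open>B\<close> of ln |W| is positive,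
  so the triangular differential of \<open>level_map\<close> is invertible. The inverse is described
  by the two equations that \<open>angle_less_on_level\<close> uses.\<close>

lemma level_map_inverse_derivative:
  assumes "z \<in> half_plane"
  shows "\<exists>g'. (inv_into half_plane level_map has_derivative g') (at (level_map z)) \<and>
    (\<forall>q. Re (g' q) = Re q \<and> Re (dW z (g' q) / W z) = Im q)"
proof -
  define A B where "A = Re (dW z 1 / W z)" and "B = Re (dW z \<i> / W z)"
  have "B = cosh (v z) * (- Im (cis (- u z) * W z)) / (norm (W z))\<^sup>2"
    unfolding B_def dW_def complex_div_cnj[of _ "W z"] by (simp add: algebra_simps)
  then have B: "B > 0"
    using Im_normal_W[OF assms] W_nz[OF assms] by simp
  have lin: "Re (dW z k / W z) = A * Re k + B * Im k" for k
  proof -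
    have "dW z k = Re k *\<^sub>R dW z 1 + Im k *\<^sub>R dW z \<i>"
      by (simp add: dW_def complex_eq_iff algebra_simps)
    then have "dW z k / W z = of_real (Re k) * (dW z 1 / W z) + of_real (Im k) * (dW z \<i> / W z)"
      by (simp add: scaleR_conv_of_real add_divide_distrib)
    then show ?thesis
      unfolding A_def B_def by (simp only: plus_complex.sel Re_complex_of_real Im_complex_of_real times_complex.sel) simp
  qed
  have der: "(level_map has_derivative (\<lambda>k. Complex (Re k) (Re (dW w k / W w)))) (at w)" if "w \<in> half_plane" for w
  proof -
    have "((\<lambda>z. of_real (Re z) + \<i> * of_real (Re (polar_log 0 z))) has_derivative
        (\<lambda>k. of_real (Re k) + \<i> * of_real (Re (dW w k / W w)))) (at w)"
      by (rule derivative_eq_intros polar_log_derivative[OF that] refl)+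
    moreover have "level_map = (\<lambda>z. of_real (Re z) + \<i> * of_real (Re (polar_log 0 z)))"
      "(\<lambda>k. Complex (Re k) (Re (dW w k / W w))) = (\<lambda>k. of_real (Re k) + \<i> * of_real (Re (dW w k / W w)))"
      by (simp_all add: fun_eq_iff complex_eq_iff level_map_def)
    ultimately show ?thesis
      by (simp only:)
  qed
  have "(inv_into half_plane level_map has_derivative (\<lambda>q. Complex (Re q) ((Im q - A * Re q) / B))) (at (level_map z))"
  proof (rule has_derivative_inv_into[OF open_half_plane inj_on_level_map _ der assms])
    show "bounded_linear (\<lambda>q. Complex (Re q) ((Im q - A * Re q) / B))"
      unfolding linear_conv_bounded_linear[symmetric]
      by (rule linearI) (simp_all add: complex_eq_iff algebra_simps diff_divide_distrib add_divide_distrib)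
    show "(\<lambda>q. Complex (Re q) ((Im q - A * Re q) / B)) \<circ> (\<lambda>k. Complex (Re k) (Re (dW z k / W z))) = id"
      using B by (simp add: lin fun_eq_iff complex_eq_iff)
  qed simp
  then show ?thesis
    using B by (intro exI[of _ "\<lambda>q. Complex (Re q) ((Im q - A * Re q) / B)"]) (simp add: lin)
qed

definition graph_region :: "complex set" where
  "graph_region = {z \<in> half_plane. norm (W z) < T (Re z)}"

text \<open>Intermediate values on the slice: the radius is 0 on the axis and at least
  \<open>T x\<close> at the rim of the larger region.\<close>

lemma level_point:
  assumes x: "\<bar>x\<bar> < 1" and r: "0 < r" "r < T x"
  obtains y where "Complex x y \<in> half_plane" "norm (W (Complex x y)) = r"
proof -
  have "continuous_on {0..Ye x} (\<lambda>y. norm (W (Complex x y)))"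
    unfolding norm_Q[symmetric]
    by (intro continuous_at_imp_continuous_on ballI continuous_norm
        has_vector_derivative_continuous[OF Q_vertical[OF vertical_in_S[OF x]]]) auto
  moreover have "r \<le> norm (W (Complex x (Ye x)))"
    using r T_upper[OF x] norm_W_lower[OF x, of "Ye x"] Ye_pos[of x] by linarith
  moreover have "norm (W (Complex x 0)) \<le> r"
    using r W_axis[OF x] by simp
  ultimately obtain y where y: "0 \<le> y" "y \<le> Ye x" "norm (W (Complex x y)) = r"
    using IVT'[of "\<lambda>y. norm (W (Complex x y))" 0 r "Ye x"] Ye_pos[of x] by auto
  moreover have "y \<noteq> 0"
    using y r W_axis[OF x] by auto
  moreover have "y \<noteq> Ye x"
    using y r T_upper[OF x] norm_W_lower[OF x, of "Ye x"] Ye_pos[of x] by auto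
  ultimately show ?thesis
    using x by (intro that[of y]) (auto simp: half_plane_def)
qed

text \<open>The curve |W| = r through \<open>w\<close> can be followed leftwards to
  \<open>z\<close>: as \<open>T\<close> is non-increasing, r stays below \<open>T x\<close> at each
  intermediate x, so that slice contains a point of radius r. Along this curve the angle has
  positive derivative in x.\<close>

lemma angle_less_on_level:
  assumes z: "z \<in> graph_region" and w: "w \<in> graph_region" and eq: "norm (W z) = norm (W w)"
    and less: "Re z < Re w"
  shows "Im (polar_log 0 z) < Im (polar_log 0 w)"
proof -
  define r where "r = norm (W z)"
  have zH: "z \<in> half_plane" and wH: "w \<in> half_plane"
    using z w by (auto simp: graph_region_def)
  have r: "0 < r" "r < T (Re w)"
    using W_nz[OF zH] w eq by (auto simp: r_def graph_region_def)
  define \<psi> where "\<psi> x = inv_into half_plane level_map (Complex x (ln r))" for x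
  have \<psi>_eq: "\<psi> (Re p) = p" if "p \<in> half_plane" "norm (W p) = r" for p
  proof -
    have "level_map p = Complex (Re p) (ln r)"
      using that by (simp add: level_map_def norm_W_exp flip: that(2))
    then show ?thesis
      unfolding \<psi>_def using inv_into_f_f[OF inj_on_level_map that(1)] by simp
  qed
  have \<psi>: "\<psi> x \<in> half_plane" "norm (W (\<psi> x)) = r" "Re (\<psi> x) = x" if x: "Re z \<le> x" "x \<le> Re w" for x
  proof -
    have "\<bar>x\<bar> < 1"
      using x zH wH by (auto simp: half_plane_def)
    moreover have "r < T x"
      using r(2) T_mono[OF x(2)] by linarith
    ultimately obtain y where y: "Complex x y \<in> half_plane" "norm (W (Complex x y)) = r"
      using level_point r(1) by metis
    then have "\<psi> x = Complex x y"
      using \<psi>_eq[of "Complex x y"] by simp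
    with y show "\<psi> x \<in> half_plane" "norm (W (\<psi> x)) = r" "Re (\<psi> x) = x"
      by simp_all
  qed
  have "Im (polar_log 0 (\<psi> (Re z))) < Im (polar_log 0 (\<psi> (Re w)))"
  proof (rule DERIV_pos_imp_increasing[OF less])
    fix x assume x: "Re z \<le> x" "x \<le> Re w"
    define p where "p = \<psi> x"
    have p: "p \<in> half_plane" "norm (W p) = r" "Re p = x"
      using \<psi>[OF x] by (simp_all add: p_def)
    have lm: "level_map p = Complex x (ln r)"
      using p by (simp add: level_map_def norm_W_exp flip: p(2))
    obtain g' where g': "(inv_into half_plane level_map has_derivative g') (at (Complex x (ln r)))"
      and Re_g': "\<And>q. Re (g' q) = Re q" "\<And>q. Re (dW p (g' q) / W p) = Im q"
      using level_map_inverse_derivative[OF p(1)] lm by auto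
    have "((\<lambda>x. Complex x (ln r)) has_derivative of_real) (at x)"
    proof -
      have "(\<lambda>x. Complex x (ln r)) = (\<lambda>x. of_real x + \<i> * of_real (ln r))"
        by (simp add: fun_eq_iff complex_eq_iff)
      then show ?thesis
        by (auto intro!: derivative_eq_intros)
    qed
    from has_derivative_compose[OF this g']
    have d\<psi>: "(\<psi> has_derivative (\<lambda>t. g' (of_real t))) (at x)"
      unfolding \<psi>_def .
    have "(polar_log 0 has_derivative (\<lambda>k. dW p k / W p)) (at (\<psi> x))"
      using polar_log_derivative[OF p(1)] by (simp add: p_def)
    from has_derivative_Im[OF has_derivative_compose[OF d\<psi> this]]
    have d: "((\<lambda>x. Im (polar_log 0 (\<psi> x))) has_derivative (\<lambda>t. Im (dW p (g' (of_real t)) / W p))) (at x)" .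
    define D where "D = Im (dW p (g' 1) / W p)"
    have "Im (dW p (g' (of_real t)) / W p) = t * D" for t
      using linear_cmul[OF has_derivative_linear[OF d], of t 1] by (simp add: D_def)
    then have "((\<lambda>x. Im (polar_log 0 (\<psi> x))) has_real_derivative D) (at x)"
      using has_derivative_imp_has_field_derivative[OF d] by simp
    \<comment> \<open>With |W| constant, dW = i D W. In the frame exp(iu) the first component of dW
      is sinh v > 0, and that of i W is -Im (exp(-iu) W) > 0.\<close>
    moreover have "0 < D"
    proof -
      have "dW p (g' 1) / W p = \<i> * of_real D"
        using Re_g'(2)[of 1] by (simp add: complex_eq_iff D_def)
      then have "dW p (g' 1) = \<i> * of_real D * W p"
        using W_nz[OF p(1)] by (simp add: field_simps)
      then have "cis (- u p) * dW p (g' 1) = \<i> * of_real D * (cis (- u p) * W p)"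
        by simp
      moreover have "cis (- u p) * dW p (g' 1) = Complex (sinh (v p) * Re (g' 1)) (- cosh (v p) * Im (g' 1))"
        by (simp add: dW_def cis_mult flip: mult.assoc)
      ultimately have "sinh (v p) = D * - Im (cis (- u p) * W p)"
        by (simp add: complex_eq_iff Re_g' algebra_simps)
      then show ?thesis
        using v_half_plane_pos[OF p(1)] Im_normal_W[OF p(1)]
        by (metis neg_0_less_iff_less sinh_real_pos_iff zero_less_mult_pos2)
    qed
    ultimately show "\<exists>D. ((\<lambda>x. Im (polar_log 0 (\<psi> x))) has_real_derivative D) (at x) \<and> 0 < D"
      by blast
  qed
  then show ?thesis
    using \<psi>_eq[OF zH] \<psi>_eq[OF wH] eq by (simp add: r_def)
qed

lemma inj_on_polar: "inj_on (polar c) graph_region"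
proof (rule inj_onI)
  fix z w assume z: "z \<in> graph_region" and w: "w \<in> graph_region" and eq: "polar c z = polar c w"
  have zH: "z \<in> half_plane" and wH: "w \<in> half_plane"
    using z w by (auto simp: graph_region_def)
  have n: "norm (W z) = norm (W w)"
    using eq fst_polar zH wH by metis
  moreover have "Im (polar_log 0 z) = Im (polar_log 0 w)"
    using eq by (simp add: polar_def polar_log_def)
  ultimately have "Re z = Re w"
    using angle_less_on_level[OF z w] angle_less_on_level[OF w z] by (metis less_irrefl linorder_neqE)
  with n have "level_map z = level_map w"
    using zH wH by (simp add: level_map_def norm_W_exp)
  then show "z = w"
    using inj_on_level_map zH wH by (meson inj_onD)
qed

lemma open_graph_region: "open graph_region"
proof -
  have "continuous_on half_plane (\<lambda>z. T (Re z) - norm (W z))"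
    using W_derivative half_plane_in_S
    by (intro continuous_intros continuous_on_compose2[OF T_cont] continuous_at_imp_continuous_on ballI)
      (auto intro: has_derivative_continuous)
  then have "open {z \<in> half_plane. T (Re z) - norm (W z) \<in> {0<..}}"
    using open_half_plane continuous_open_preimage[of half_plane "\<lambda>z. T (Re z) - norm (W z)" "{0<..}"]
    by (simp add: vimage_def Int_def)
  then show ?thesis
    by (simp add: graph_region_def)
qed

lemma polar_derivative:
  assumes "z \<in> half_plane"
  shows "(polar c has_derivative (\<lambda>k. (norm (W z) * Re (dW z k / W z), Im (dW z k / W z)))) (at z)"
proof -
  have "exp (Re (polar_log c z)) = norm (W z)"
    using fst_polar[OF assms, of c] by (simp add: polar_def)
  then show ?thesis
    unfolding polar_def[abs_def]
    by (auto intro!: derivative_eq_intros polar_log_derivative[OF assms])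
qed

lemma continuous_on_polar: "continuous_on half_plane (polar c)"
  using polar_derivative by (auto intro!: continuous_at_imp_continuous_on intro: has_derivative_continuous)

lemma polar_image_open: "open B \<Longrightarrow> B \<subseteq> graph_region \<Longrightarrow> open (polar c ` B)"
  by (rule invariance_of_domain_gen[OF _ continuous_on_subset[OF continuous_on_polar] inj_on_subset[OF inj_on_polar]])
    (auto simp: graph_region_def)

definition polar_inv :: "real \<Rightarrow> real \<times> real \<Rightarrow> complex" where
  "polar_inv c = inv_into graph_region (polar c)"

lemma polar_inv_polar: "z \<in> graph_region \<Longrightarrow> polar_inv c (polar c z) = z"
  by (simp add: polar_inv_def inj_on_polar)

text \<open>\<open>X\<close> is the velocity of \<open>W\<close>, written as cis (-c) times \<rho>
  exp(i \<theta>), for a polar velocity (r, s), expressed in the frame exp(iu). There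
  \<open>dW\<close> is diagonal with entries sinh v and -cosh v, and v > 0, so dividing by them
  inverts it.\<close>

lemma polar_inv_derivative:
  assumes "w \<in> polar c ` graph_region"
  defines "z \<equiv> polar_inv c w"
  defines "X \<equiv> \<lambda>(r, s). cis (- u z) * (cis (- c) * cis (snd w) * (of_real r + \<i> * of_real (fst w) * of_real s))"
  shows "z \<in> half_plane"
    and "(polar_inv c has_derivative (\<lambda>k. of_real (Re (X k) / sinh (v z)) - \<i> * of_real (Im (X k) / cosh (v z)))) (at w)"
proof -
  obtain z' where "z' \<in> graph_region" "w = polar c z'"
    using assms by blast
  then have z: "z \<in> graph_region" "polar c z = w"
    using polar_inv_polar by (auto simp: z_def)
  then show zH: "z \<in> half_plane"
    by (simp add: graph_region_def)
  have W: "W z = cis (- c) * (of_real (fst w) * cis (snd w))"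
  proof -
    have "cis (- c) * (cis c * W z) = cis (- c) * (of_real (fst w) * cis (snd w))"
      using W_polar[OF zH, of c] z by (simp add: scaleR_conv_of_real)
    then show ?thesis
      by (simp add: cis_mult flip: mult.assoc)
  qed
  have fst_w: "fst w = norm (W z)" "fst w \<noteq> 0"
    using fst_polar[OF zH, of c] z W_nz[OF zH] by auto
  show "(polar_inv c has_derivative (\<lambda>k. of_real (Re (X k) / sinh (v z)) - \<i> * of_real (Im (X k) / cosh (v z)))) (at w)"
    unfolding polar_inv_def z(2)[symmetric]
  proof (rule has_derivative_inv_into[OF open_graph_region inj_on_polar _ polar_derivative z(1)])
    have "bounded_linear X"
    proof -
      have "X = (\<lambda>k. cis (- u z) * (cis (- c) * cis (snd w) * (of_real (fst k) + \<i> * of_real (fst w) * of_real (snd k))))"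
        by (simp add: X_def fun_eq_iff split: prod.split)
      then show ?thesis
        by (auto intro!: bounded_linear_intros bounded_linear_compose[OF bounded_linear_of_real])
    qed
    then show "bounded_linear (\<lambda>k. of_real (Re (X k) / sinh (v z)) - \<i> * of_real (Im (X k) / cosh (v z)))"
      unfolding linear_conv_bounded_linear[symmetric]
      by (intro linearI) (simp_all add: linear_add linear_cmul complex_eq_iff add_divide_distrib)
    have "X (norm (W z) * Re (dW z k / W z), Im (dW z k / W z)) = Complex (sinh (v z) * Re k) (- cosh (v z) * Im k)" for k
    proof -
      let ?q = "dW z k / W z"
      have "X (norm (W z) * r, s) = cis (- u z) * (W z * (of_real r + \<i> * of_real s))" for r s
        unfolding X_def fst_w(1)[symmetric] by (subst W) (simp add: algebra_simps)
      then have "X (norm (W z) * Re ?q, Im ?q) = cis (- u z) * (W z * (of_real (Re ?q) + \<i> * of_real (Im ?q)))" .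
      also have "of_real (Re ?q) + \<i> * of_real (Im ?q) = ?q"
        by (rule complex_eq[symmetric])
      also have "cis (- u z) * (W z * ?q) = (cis (- u z) * cis (u z)) * Complex (sinh (v z) * Re k) (- cosh (v z) * Im k)"
        using W_nz[OF zH] by (simp add: dW_def)
      finally show ?thesis
        by (simp add: cis_mult)
    qed
    then show "(\<lambda>k. of_real (Re (X k) / sinh (v z)) - \<i> * of_real (Im (X k) / cosh (v z))) \<circ>
        (\<lambda>k. (norm (W z) * Re (dW z k / W z), Im (dW z k / W z))) = id"
      using v_half_plane_pos[OF zH] by (simp add: fun_eq_iff complex_eq_iff)
  qed (auto simp: graph_region_def)
qed

subsection \<open>Smoothness of the height as a function of polar coordinates\<close>

text \<open>An algebra of functions of the polar coordinates that is closed under differentiation because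
  the derivative of \<open>polar_inv\<close> is itself expressed in it.\<close>

inductive_set polar_class :: "real \<Rightarrow> (real \<times> real \<Rightarrow> complex) set" for c where
  const: "(\<lambda>_. a) \<in> polar_class c"
| radius: "(\<lambda>w. of_real (fst w)) \<in> polar_class c"
| angle: "(\<lambda>w. cis (snd w)) \<in> polar_class c"
| hol: "H holomorphic_on S \<Longrightarrow> (\<lambda>w. H (polar_inv c w)) \<in> polar_class c"
| add: "a \<in> polar_class c \<Longrightarrow> b \<in> polar_class c \<Longrightarrow> (\<lambda>w. a w + b w) \<in> polar_class c"
| mult: "a \<in> polar_class c \<Longrightarrow> b \<in> polar_class c \<Longrightarrow> (\<lambda>w. a w * b w) \<in> polar_class c"
| cnj: "a \<in> polar_class c \<Longrightarrow> (\<lambda>w. cnj (a w)) \<in> polar_class c"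
| inverse: "a \<in> polar_class c \<Longrightarrow> (\<And>w. w \<in> polar c ` graph_region \<Longrightarrow> a w \<noteq> 0) \<Longrightarrow>
    (\<lambda>w. inverse (a w)) \<in> polar_class c"

lemma polar_inv_derivative_in_class:
  "\<exists>D. (\<forall>w \<in> polar c ` graph_region. (polar_inv c has_derivative D w) (at w)) \<and> (\<forall>k. (\<lambda>w. D w k) \<in> polar_class c)"
proof -
  \<comment> \<open>u and v are not holomorphic, so exp(-iu) and exp(v) are assembled from
    holomorphic exponentials exp(bh) and their conjugates.\<close>
  define E where "E b w = exp (b * h (polar_inv c w))" for b w
  have E: "E b \<in> polar_class c" for b
    unfolding E_def[abs_def] using h S
    by (intro polar_class.hol holomorphic_intros) (auto simp: holomorphic_on_open)
  define Eu where "Eu w = E (- \<i> / 2) w * cnj (E (\<i> / 2) w)" for w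
  define Ev where "Ev w = E (- \<i> / 2) w * cnj (E (- \<i> / 2) w)" for w
  have Eu: "Eu w = cis (- u (polar_inv c w))" for w
    unfolding Eu_def E_def exp_cnj exp_add[symmetric] cis_conv_exp
    by (rule arg_cong[of _ _ exp]) (simp add: complex_eq_iff)
  have Ev: "Ev w = of_real (exp (v (polar_inv c w)))" for w
    unfolding Ev_def E_def exp_cnj exp_add[symmetric] exp_of_real[symmetric]
    by (rule arg_cong[of _ _ exp]) (simp add: complex_eq_iff)
  have Ev_class: "Ev \<in> polar_class c" and Eu_class: "Eu \<in> polar_class c"
    unfolding Ev_def[abs_def] Eu_def[abs_def] by (intro polar_class.intros E)+
  \<comment> \<open>\<open>C (-1)\<close> is 2 sinh v, invertible because v > 0 on the half-plane
    region; \<open>C 1\<close> is 2 cosh v.\<close>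
  define C where "C s w = Ev w + of_real s * inverse (Ev w)" for s w
  have C: "C s \<in> polar_class c" for s
    unfolding C_def[abs_def] by (intro polar_class.intros Ev_class) (simp add: Ev)
  have C_sinh: "C (-1) w = of_real (2 * sinh (v (polar_inv c w)))" for w
    by (simp add: C_def Ev sinh_field_def exp_minus)
  have C_cosh: "C 1 w = of_real (2 * cosh (v (polar_inv c w)))" for w
    by (simp add: C_def Ev cosh_field_def exp_minus)
  define X where "X k w = Eu w * (cis (- c) * cis (snd w) * (of_real (fst k) + \<i> * of_real (fst w) * of_real (snd k)))" for k :: "real \<times> real" and w
  have X: "X k \<in> polar_class c" for k
    unfolding X_def[abs_def] by (intro polar_class.intros Eu_class)
  \<comment> \<open>Real and imaginary parts are taken through the conjugate, as 2 Re X and 2i Im X;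
    the factors 2 cancel against those in \<open>C\<close>.\<close>
  define D where "D w k = (X k w + cnj (X k w)) * inverse (C (-1) w) + (-1) * (X k w + (-1) * cnj (X k w)) * inverse (C 1 w)" for w k
  have "(\<lambda>w. D w k) \<in> polar_class c" for k
    unfolding D_def
  proof (intro polar_class.intros X C)
    fix w assume "w \<in> polar c ` graph_region"
    then show "C (-1) w \<noteq> 0"
      using polar_inv_derivative(1) v_half_plane_pos unfolding C_sinh by fastforce
    show "C 1 w \<noteq> 0"
      unfolding C_cosh by simp
  qed
  moreover have "(polar_inv c has_derivative D w) (at w)" if "w \<in> polar c ` graph_region" for w
  proof (rule has_derivative_eq_rhs[OF polar_inv_derivative(2)[OF that]])
    show "(\<lambda>k. of_real (Re (case k of (r, s) \<Rightarrow> cis (- u (polar_inv c w)) * (cis (- c) * cis (snd w) * (of_real r + \<i> * of_real (fst w) * of_real s))) / sinh (v (polar_inv c w))) -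
      \<i> * of_real (Im (case k of (r, s) \<Rightarrow> cis (- u (polar_inv c w)) * (cis (- c) * cis (snd w) * (of_real r + \<i> * of_real (fst w) * of_real s))) / cosh (v (polar_inv c w)))) = D w"
    proof
      fix k :: "real \<times> real"
      have X: "(case k of (r, s) \<Rightarrow> cis (- u (polar_inv c w)) * (cis (- c) * cis (snd w) * (of_real r + \<i> * of_real (fst w) * of_real s))) = X k w"
        by (simp add: X_def Eu split: prod.split)
      have 2: "of_real (a / s) - \<i> * of_real (b / t) =
          of_real (2 * a) * inverse (of_real (2 * s)) + (-1) * (\<i> * of_real (2 * b)) * inverse (of_real (2 * t))" for a b s t
      proof -
        have "2 * a * inverse (2 * s) = a / s" "2 * b * inverse (2 * t) = b / t"
          by (simp_all add: divide_simps)
        then have "of_real (2 * a) * inverse (of_real (2 * s)) = (of_real (a / s) :: complex)"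
          "of_real (2 * b) * inverse (of_real (2 * t)) = (of_real (b / t) :: complex)"
          by (metis of_real_inverse of_real_mult)+
        moreover have "(-1) * (\<i> * B) * C = - (\<i> * (B * C))" for B C
          by simp
        ultimately show ?thesis
          by (simp only: diff_conv_add_uminus)
      qed
      have 1: "X k w + cnj (X k w) = of_real (2 * Re (X k w))" "X k w + (-1) * cnj (X k w) = \<i> * of_real (2 * Im (X k w))"
        by (simp_all add: complex_eq_iff)
      show "of_real (Re (case k of (r, s) \<Rightarrow> cis (- u (polar_inv c w)) * (cis (- c) * cis (snd w) * (of_real r + \<i> * of_real (fst w) * of_real s))) / sinh (v (polar_inv c w))) -
      \<i> * of_real (Im (case k of (r, s) \<Rightarrow> cis (- u (polar_inv c w)) * (cis (- c) * cis (snd w) * (of_real r + \<i> * of_real (fst w) * of_real s))) / cosh (v (polar_inv c w))) = D w k"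
        unfolding X D_def 1 C_sinh C_cosh by (rule 2)
    qed
  qed
  ultimately show ?thesis
    by blast
qed

lemma polar_class_closed:
  assumes "a \<in> polar_class c"
  shows "\<exists>a'. (\<forall>w \<in> polar c ` graph_region. (a has_derivative a' w) (at w)) \<and> (\<forall>k. (\<lambda>w. a' w k) \<in> polar_class c)"
  using assms
proof induction
  case (const a)
  show ?case
    by (rule exI[of _ "\<lambda>_ _. 0"]) (auto intro: polar_class.const)
next
  case radius
  show ?case
    by (rule exI[of _ "\<lambda>_ k. of_real (fst k)"]) (auto intro!: polar_class.const derivative_eq_intros)
next
  case angle
  have "((\<lambda>w. cis (snd w)) has_derivative (\<lambda>k. (\<i> * cis (snd w)) * of_real (snd k))) (at w)" for w :: "real \<times> real"
  proof -
    have "((\<lambda>w. \<i> * of_real (snd w)) has_derivative (\<lambda>k. \<i> * of_real (snd k))) (at w)"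
      by (auto intro!: derivative_eq_intros)
    from has_derivative_compose[OF this DERIV_exp[THEN has_field_derivative_imp_has_derivative]]
    show ?thesis
      unfolding cis_conv_exp by (simp add: mult_ac)
  qed
  then show ?case
    by (intro exI[of _ "\<lambda>w k. (\<i> * cis (snd w)) * of_real (snd k)"]) (auto intro!: polar_class.intros)
next
  case (hol H)
  obtain D where D: "\<And>w. w \<in> polar c ` graph_region \<Longrightarrow> (polar_inv c has_derivative D w) (at w)"
    "\<And>k. (\<lambda>w. D w k) \<in> polar_class c"
    using polar_inv_derivative_in_class by blast
  have "((\<lambda>w. H (polar_inv c w)) has_derivative (\<lambda>k. deriv H (polar_inv c w) * D w k)) (at w)"
    if "w \<in> polar c ` graph_region" for w
    by (rule has_derivative_compose[OF D(1)[OF that] has_field_derivative_imp_has_derivative[OF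
            holomorphic_derivI[OF hol S half_plane_in_S[OF polar_inv_derivative(1)[OF that]]]]])
  moreover have "(\<lambda>w. deriv H (polar_inv c w) * D w k) \<in> polar_class c" for k
    using holomorphic_deriv[OF hol S] by (intro polar_class.mult polar_class.hol D(2))
  ultimately show ?case
    by (intro exI[of _ "\<lambda>w k. deriv H (polar_inv c w) * D w k"]) auto
next
  case (add a b)
  then obtain a' b' where "\<forall>w \<in> polar c ` graph_region. (a has_derivative a' w) (at w)" "\<forall>k. (\<lambda>w. a' w k) \<in> polar_class c"
    "\<forall>w \<in> polar c ` graph_region. (b has_derivative b' w) (at w)" "\<forall>k. (\<lambda>w. b' w k) \<in> polar_class c"
    by blast
  then show ?case
    by (intro exI[of _ "\<lambda>w k. a' w k + b' w k"]) (auto intro!: polar_class.intros has_derivative_add)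
next
  case (mult a b)
  then obtain a' b' where "\<forall>w \<in> polar c ` graph_region. (a has_derivative a' w) (at w)" "\<forall>k. (\<lambda>w. a' w k) \<in> polar_class c"
    "\<forall>w \<in> polar c ` graph_region. (b has_derivative b' w) (at w)" "\<forall>k. (\<lambda>w. b' w k) \<in> polar_class c"
    by blast
  with mult.hyps show ?case
    by (intro exI[of _ "\<lambda>w k. a w * b' w k + a' w k * b w"]) (auto intro!: polar_class.intros has_derivative_mult)
next
  case (cnj a)
  then obtain a' where "\<forall>w \<in> polar c ` graph_region. (a has_derivative a' w) (at w)" "\<forall>k. (\<lambda>w. a' w k) \<in> polar_class c"
    by blast
  then show ?case
    by (intro exI[of _ "\<lambda>w k. cnj (a' w k)"]) (auto intro!: polar_class.intros has_derivative_cnj)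
next
  case (inverse a)
  then obtain a' where a': "\<forall>w \<in> polar c ` graph_region. (a has_derivative a' w) (at w)" "\<forall>k. (\<lambda>w. a' w k) \<in> polar_class c"
    by blast
  have "((\<lambda>w. inverse (a w)) has_derivative (\<lambda>k. (-1) * (inverse (a w) * a' w k * inverse (a w)))) (at w)" if "w \<in> polar c ` graph_region" for w
    using Deriv.has_derivative_inverse[OF inverse.hyps(2)[OF that] bspec[OF a'(1) that]] by simp
  moreover have "(\<lambda>w. (-1) * (inverse (a w) * a' w k * inverse (a w))) \<in> polar_class c" for k
    by (intro polar_class.const polar_class.mult polar_class.inverse inverse.hyps a'(2)[rule_format])
  ultimately show ?case
    by (intro exI[of _ "\<lambda>w k. (-1) * (inverse (a w) * a' w k * inverse (a w))"]) auto
qed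

lemma smooth_on_height: "smooth_on (polar c ` graph_region) (\<lambda>w. Re (polar_inv c w))"
proof (rule smooth_on_of_closed_class[where \<F> = "{\<lambda>w. Re (a w) | a. a \<in> polar_class c}"])
  show "open (polar c ` graph_region)"
    by (simp add: polar_image_open open_graph_region)
  have "(\<lambda>w. polar_inv c w) \<in> polar_class c"
    by (rule polar_class.hol) (rule holomorphic_on_ident)
  then show "(\<lambda>w. Re (polar_inv c w)) \<in> {\<lambda>w. Re (a w) | a. a \<in> polar_class c}"
    by blast
next
  fix g assume "g \<in> {\<lambda>w. Re (a w) | a. a \<in> polar_class c}"
  then obtain a where a: "a \<in> polar_class c" "g = (\<lambda>w. Re (a w))"
    by blast
  then obtain a' where a': "\<forall>w \<in> polar c ` graph_region. (a has_derivative a' w) (at w)" "\<forall>k. (\<lambda>w. a' w k) \<in> polar_class c"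
    using polar_class_closed by blast
  then show "\<exists>g'. (\<forall>w\<in>polar c ` graph_region. (g has_derivative g' w) (at w)) \<and>
      (\<forall>k. (\<lambda>w. g' w k) \<in> {\<lambda>w. Re (a w) | a. a \<in> polar_class c})"
    unfolding a by (intro exI[of _ "\<lambda>w k. Re (a' w k)"]) (auto intro: has_derivative_Re)
qed

end

section \<open>Arcs and disks\<close>

text \<open>Two arcs with the same image differ by a continuous injection of [0,1] onto itself. It
  is strictly monotone, hence sends 0 to 0 or to 1.\<close>

lemma arc_endpoints_path_image:
  assumes "arc g"
  shows "arc_endpoints (path_image g) = {pathstart g, pathfinish g}"
proof -
  obtain k where k: "homeomorphism {0..1} (path_image g) g k"
    using homeomorphism_arc[OF assms] .
  have "pathstart \<gamma> \<in> {pathstart g, pathfinish g}" if \<gamma>: "arc \<gamma>" "path_image \<gamma> = path_image g" for \<gamma>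
  proof -
    let ?\<phi> = "\<lambda>t. k (\<gamma> t)"
    have img: "\<gamma> ` {0..1} = path_image g"
      using \<gamma>(2) by (simp add: path_image_def)
    have \<phi>_img: "?\<phi> ` {0..1} = {0..1}"
      using k img by (metis homeomorphism_image2 image_image)
    have "continuous_on {0..1} ?\<phi>"
      using \<gamma>(1) k img by (intro continuous_on_compose2[OF homeomorphism_cont2[OF k]]) (auto simp: arc_def path_def)
    moreover have "inj_on ?\<phi> {0..1}"
    proof -
      have "inj_on k (path_image g)"
        using k by (metis homeomorphism_apply2 inj_on_inverseI)
      then show ?thesis
        using comp_inj_on[of \<gamma> "{0..1}" k] \<gamma>(1) img by (simp add: arc_def o_def)
    qed
    ultimately consider "strict_mono_on {0..1} ?\<phi>" | "strict_antimono_on {0..1} ?\<phi>"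
      using injective_eq_monotone_map[of "{0..1}" ?\<phi>] by (auto simp: is_interval_cc)
    then have "?\<phi> 0 \<in> {0, 1}"
    proof cases
      case 1
      obtain t where "t \<in> {0..1}" "?\<phi> t = 0"
        using \<phi>_img by (metis atLeastAtMost_iff imageE order_refl zero_le_one)
      moreover have "?\<phi> 0 \<in> {0..1}"
        using \<phi>_img by (metis atLeastAtMost_iff imageI order_refl zero_le_one)
      ultimately show ?thesis
        using strict_mono_onD[OF 1, of 0 t] by (cases "t = 0") auto
    next
      case 2
      obtain t where "t \<in> {0..1}" "?\<phi> t = 1"
        using \<phi>_img by (metis atLeastAtMost_iff imageE order_refl zero_le_one)
      moreover have "?\<phi> 0 \<in> {0..1}"
        using \<phi>_img by (metis atLeastAtMost_iff imageI order_refl zero_le_one)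
      ultimately show ?thesis
        using monotone_onD[OF 2, of 0 t] by (cases "t = 0") auto
    qed
    moreover have "\<gamma> 0 = g (?\<phi> 0)"
      using k img by (metis atLeastAtMost_iff homeomorphism_apply2 imageI order_refl zero_le_one)
    ultimately show ?thesis
      by (auto simp: pathstart_def pathfinish_def)
  qed
  moreover have "pathstart g \<in> arc_endpoints (path_image g)"
    using assms by (auto simp: arc_endpoints_def)
  moreover have "pathfinish g \<in> arc_endpoints (path_image g)"
    unfolding arc_endpoints_def using assms arc_reversepath[of g]
    by (intro CollectI exI[of _ "reversepath g"]) auto
  ultimately show ?thesis
    by (auto simp: arc_endpoints_def)
qed

lemma image_subset_closure_image:
  assumes "continuous_on A f" "B \<subseteq> A" "A \<subseteq> closure B"
  shows "f ` A \<subseteq> closure (f ` B)"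
proof -
  have "closedin (top_of_set A) (A \<inter> f -` closure (f ` B))"
    using assms(1) by (intro continuous_closedin_preimage) auto
  then obtain C where C: "closed C" "A \<inter> f -` closure (f ` B) = A \<inter> C"
    by (auto simp: closedin_closed)
  have "B \<subseteq> A \<inter> f -` closure (f ` B)"
    using assms(2) closure_subset by fastforce
  then have "closure B \<subseteq> C"
    using C by (intro closure_minimal) auto
  then show ?thesis
    using C assms(3) by blast
qed

text \<open>The joins nest to the right, so the four sides occupy [0,1/2], [1/2,3/4], [3/4,7/8] and
  [7/8,1], run through at 2, 4, 8 and 8 times the speed of \<open>linepath\<close>.\<close>

lemma rectpath_derivative:
  assumes ab: "Re a \<noteq> Re b" "Im a \<noteq> Im b" and t: "t \<in> {0..1} - {0, 1/2, 3/4, 7/8, 1}"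
  obtains q where "q \<noteq> 0" "(rectpath a b has_vector_derivative q) (at t)"
proof -
  define a2 a4 where "a2 = Complex (Re b) (Im a)" and "a4 = Complex (Re a) (Im b)"
  have ne: "a2 \<noteq> a" "b \<noteq> a2" "a4 \<noteq> b" "a \<noteq> a4"
    using ab by (auto simp: a2_def a4_def complex_eq_iff)
  have rp: "rectpath a b = linepath a a2 +++ linepath a2 b +++ linepath b a4 +++ linepath a4 a"
    by (simp add: rectpath_def Let_def a2_def a4_def)
  have piece: "\<exists>q. q \<noteq> 0 \<and> (rectpath a b has_vector_derivative q) (at t)"
    if pq: "p \<noteq> q" and k: "k > 0" and "l < t" "t < r"
      and eq: "\<And>s. l < s \<Longrightarrow> s < r \<Longrightarrow> rectpath a b s = linepath p q (k * s - m)" for p q :: complex and k m l r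
  proof (intro exI conjI)
    show "k *\<^sub>R (q - p) \<noteq> 0"
      using pq k by simp
    have "((\<lambda>s. linepath p q (k * s - m)) has_vector_derivative (k *\<^sub>R (q - p))) (at t)"
      unfolding linepath_def by (auto intro!: derivative_eq_intros simp: algebra_simps)
    then show "(rectpath a b has_vector_derivative (k *\<^sub>R (q - p))) (at t)"
      by (rule has_vector_derivative_transform_within_open[where S = "{l<..<r}"]) (use that in auto)
  qed
  from t consider "0 < t \<and> t < 1/2" | "1/2 < t \<and> t < 3/4" | "3/4 < t \<and> t < 7/8" | "7/8 < t \<and> t < 1"
    by fastforce
  then have "\<exists>q. q \<noteq> 0 \<and> (rectpath a b has_vector_derivative q) (at t)"
  proof cases
    case 1
    then show ?thesis
      by (intro piece[of a a2 2 0 "1/2" 0]) (use ne in \<open>auto simp: rp joinpaths_def\<close>)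
  next
    case 2
    then show ?thesis
      by (intro piece[of a2 b 4 "1/2" "3/4" 2]) (use ne in \<open>auto simp: rp joinpaths_def\<close>)
  next
    case 3
    then show ?thesis
      by (intro piece[of b a4 8 "3/4" "7/8" 6]) (use ne in \<open>auto simp: rp joinpaths_def\<close>)
  next
    case 4
    then show ?thesis
      by (intro piece[of a4 a 8 "7/8" 1 7]) (use ne in \<open>auto simp: rp joinpaths_def\<close>)
  qed
  then show ?thesis
    using that by blast
qed

context helicoidal
begin

subsection \<open>The disk\<close>

text \<open>Carries the rectangle |x| \<le> 1/2, |y| \<le> 1 onto the disk. As a homeomorphism of
  the whole plane it also transports frontiers.\<close>

definition stretch :: "complex \<Rightarrow> complex" where
  "stretch z = Complex (Re z) (Im z * Y (Re z))"

definition unstretch :: "complex \<Rightarrow> complex" where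
  "unstretch z = Complex (Re z) (Im z / Y (Re z))"

definition disk :: "complex set" where
  "disk = {z. \<bar>Re z\<bar> \<le> 1/2 \<and> \<bar>Im z\<bar> \<le> Y (Re z)}"

abbreviation lo :: complex where "lo \<equiv> Complex (- 1/2) (- 1)"
abbreviation hi :: complex where "hi \<equiv> Complex (1/2) 1"

lemma stretch_unstretch [simp]: "stretch (unstretch z) = z" "unstretch (stretch z) = z"
  using Y_pos[of "Re z"] by (simp_all add: stretch_def unstretch_def complex_eq_iff)

lemma isCont_Y: "isCont Y x"
  using Y_deriv by (rule DERIV_isCont)

lemma continuous_on_Y: "continuous_on UNIV Y"
  by (simp add: continuous_at_imp_continuous_on isCont_Y)

lemma homeomorphism_stretch: "homeomorphism UNIV UNIV stretch unstretch"
proof -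
  have Y: "continuous_on UNIV (\<lambda>z. Y (Re z))"
    by (rule continuous_on_compose2[OF continuous_on_Y continuous_on_Re[OF continuous_on_id]]) auto
  have "stretch = (\<lambda>z. of_real (Re z) + \<i> * of_real (Im z * Y (Re z)))"
    "unstretch = (\<lambda>z. of_real (Re z) + \<i> * of_real (Im z / Y (Re z)))"
    by (simp_all add: fun_eq_iff complex_eq_iff stretch_def unstretch_def)
  moreover have "continuous_on UNIV (\<lambda>z. of_real (Re z) + \<i> * of_real (Im z * Y (Re z)))"
    by (intro continuous_on_add continuous_on_mult continuous_on_of_real continuous_on_const Y continuous_intros)
  moreover have "continuous_on UNIV (\<lambda>z. of_real (Re z) + \<i> * of_real (Im z / Y (Re z)))"
    using Y_pos by (intro continuous_on_add continuous_on_mult continuous_on_of_real continuous_on_const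
        continuous_on_divide Y continuous_intros) (auto simp: less_imp_neq[symmetric])
  ultimately have "continuous_on UNIV stretch" "continuous_on UNIV unstretch"
    by (simp_all only:)
  then show ?thesis
    by (intro homeomorphismI) auto
qed

lemma continuous_on_stretch: "continuous_on A stretch"
  using homeomorphism_stretch by (meson continuous_on_subset homeomorphism_cont1 subset_UNIV)

lemma inj_stretch: "inj stretch"
  by (metis injI stretch_unstretch(2))

lemma stretch_image: "stretch ` A = {z. unstretch z \<in> A}"
  by (auto simp: image_iff) (metis stretch_unstretch(1))

lemma disk_stretch: "disk = stretch ` cbox lo hi"
  unfolding stretch_image disk_def unstretch_def
  by (auto simp: in_cbox_complex_iff abs_le_iff pos_divide_le_eq pos_le_divide_eq Y_pos)

lemma stretch_rim: "stretch ` (cbox lo hi - box lo hi) = {z \<in> disk. \<bar>Re z\<bar> = 1/2 \<or> \<bar>Im z\<bar> = Y (Re z)}"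
  unfolding stretch_image disk_def unstretch_def
  by (auto simp: in_cbox_complex_iff in_box_complex_iff abs_le_iff pos_divide_le_eq pos_le_divide_eq
      pos_divide_less_eq pos_less_divide_eq Y_pos not_less)

lemma frontier_disk: "frontier disk = {z \<in> disk. \<bar>Re z\<bar> = 1/2 \<or> \<bar>Im z\<bar> = Y (Re z)}"
proof -
  have "homeomorphic_map euclidean euclidean stretch"
    unfolding homeomorphic_map_maps homeomorphic_maps_def using homeomorphism_stretch
    by (intro exI[of _ unstretch]) (auto simp: homeomorphism_def)
  then have "frontier disk = stretch ` frontier (cbox lo hi)"
    using homeomorphic_map_frontier_of[of euclidean euclidean stretch "cbox lo hi"] by (simp add: disk_stretch)
  also have "\<dots> = stretch ` (cbox lo hi - box lo hi)"
    by (simp add: frontier_cbox)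
  also have "\<dots> = {z \<in> disk. \<bar>Re z\<bar> = 1/2 \<or> \<bar>Im z\<bar> = Y (Re z)}"
    by (rule stretch_rim)
  finally show ?thesis .
qed

lemma stretch_curve_derivative:
  assumes "(g has_vector_derivative q) (at t)"
  shows "(stretch \<circ> g has_vector_derivative
    Complex (Re q) (Im q * Y (Re (g t)) + Im (g t) * (Y' (Re (g t)) * Re q))) (at t)"
proof -
  note g = assms[unfolded has_vector_derivative_def]
  have Y: "((\<lambda>t. Y (Re (g t))) has_derivative (\<lambda>k. Y' (Re (g t)) * Re (k *\<^sub>R q))) (at t)"
    by (rule has_derivative_compose[OF has_derivative_Re[OF g] Y_deriv[unfolded has_field_derivative_def]])
  have "((\<lambda>t. of_real (Re (g t)) + \<i> * of_real (Im (g t) * Y (Re (g t)))) has_derivative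
    (\<lambda>k. of_real (Re (k *\<^sub>R q)) + \<i> * of_real (Im (g t) * (Y' (Re (g t)) * Re (k *\<^sub>R q)) + Im (k *\<^sub>R q) * Y (Re (g t))))) (at t)"
    by (intro has_derivative_add has_derivative_mult_right has_derivative_of_real has_derivative_mult
        has_derivative_Re[OF g] has_derivative_Im[OF g] Y)
  moreover have "stretch \<circ> g = (\<lambda>t. of_real (Re (g t)) + \<i> * of_real (Im (g t) * Y (Re (g t))))"
    by (simp add: fun_eq_iff complex_eq_iff stretch_def)
  moreover have "(\<lambda>k. of_real (Re (k *\<^sub>R q)) + \<i> * of_real (Im (g t) * (Y' (Re (g t)) * Re (k *\<^sub>R q)) + Im (k *\<^sub>R q) * Y (Re (g t)))) =
    (\<lambda>k. k *\<^sub>R Complex (Re q) (Im q * Y (Re (g t)) + Im (g t) * (Y' (Re (g t)) * Re q)))"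
    by (simp add: fun_eq_iff complex_eq_iff algebra_simps)
  ultimately show ?thesis
    by (simp only: has_vector_derivative_def)
qed

lemma closed_disk_domain_disk: "closed_disk_domain disk"
  unfolding closed_disk_domain_def
proof
  have "cbox lo hi homeomorphic disk"
    using homeomorphism_of_subsets[OF homeomorphism_stretch] unfolding disk_stretch homeomorphic_def by blast
  moreover have "cbox lo hi homeomorphic (cball 0 1 :: complex set)"
    by (intro homeomorphic_convex_compact) (auto simp: box_ne_empty Basis_complex_def interior_cbox)
  ultimately show "disk homeomorphic (cball 0 1 :: complex set)"
    using homeomorphic_sym homeomorphic_trans by blast
next
  let ?\<gamma> = "stretch \<circ> rectpath lo hi"
  obtain S' where S': "finite S'" "rectpath lo hi C1_differentiable_on {0..1} - S'"
    using valid_path_rectpath[of lo hi] by (auto simp: valid_path_def piecewise_C1_differentiable_on_def)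
  \<comment> \<open>The exceptional parameters of the rectangle path, enlarged by its corners and
    both end parameters.\<close>
  define S0 where "S0 = S' \<union> {0, 1/2, 3/4, 7/8, 1}"
  obtain D where D: "\<And>t. t \<in> {0..1} - S' \<Longrightarrow> (rectpath lo hi has_vector_derivative D t) (at t)"
    "continuous_on ({0..1} - S') D"
    using S'(2) unfolding C1_differentiable_on_def by blast
  define E where "E t = Complex (Re (D t)) (Im (D t) * Y (Re (rectpath lo hi t)) +
    Im (rectpath lo hi t) * (Y' (Re (rectpath lo hi t)) * Re (D t)))" for t
  have E: "(?\<gamma> has_vector_derivative E t) (at t)" if "t \<in> {0..1} - S'" for t
    unfolding E_def by (rule stretch_curve_derivative[OF D(1)[OF that]])
  have cont: "continuous_on ({0..1} - S0) E"
  proof -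
    have D': "continuous_on ({0..1} - S0) D" and g: "continuous_on ({0..1} - S0) (rectpath lo hi)"
      using D(2) path_rectpath[of lo hi] by (auto simp: S0_def path_def intro: continuous_on_subset)
    have Y: "continuous_on ({0..1} - S0) (\<lambda>t. Y (Re (rectpath lo hi t)))"
      by (rule continuous_on_compose2[OF continuous_on_Y continuous_on_Re[OF g]]) auto
    have Y': "continuous_on ({0..1} - S0) (\<lambda>t. Y' (Re (rectpath lo hi t)))"
      by (rule continuous_on_compose2[OF Y'_cont continuous_on_Re[OF g]]) auto
    have E_eq: "E = (\<lambda>t. of_real (Re (D t)) + \<i> * of_real (Im (D t) * Y (Re (rectpath lo hi t)) +
      Im (rectpath lo hi t) * (Y' (Re (rectpath lo hi t)) * Re (D t))))"
      by (simp add: E_def fun_eq_iff complex_eq_iff)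
    show ?thesis
      unfolding E_eq by (intro continuous_on_add continuous_on_mult continuous_on_of_real continuous_on_Re
          continuous_on_Im continuous_on_const D' g Y Y')
  qed
  show "\<exists>\<gamma> S. simple_path \<gamma> \<and> pathfinish \<gamma> = pathstart \<gamma> \<and> path_image \<gamma> = frontier disk \<and>
      finite S \<and> \<gamma> C1_differentiable_on {0..1} - S \<and>
      (\<forall>t\<in>{0..1} - S. vector_derivative \<gamma> (at t) \<noteq> 0)"
  proof (intro exI conjI)
    show "simple_path ?\<gamma>"
      by (intro simple_path_continuous_image continuous_on_stretch simple_path_rectpath inj_on_subset[OF inj_stretch]) auto
    show "pathfinish ?\<gamma> = pathstart ?\<gamma>"
      by (simp add: pathfinish_compose pathstart_compose)
    show "path_image ?\<gamma> = frontier disk"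
      unfolding path_image_compose frontier_disk stretch_rim[symmetric]
      by (simp add: path_image_rectpath_cbox_minus_box)
    show "finite S0"
      using S'(1) by (simp add: S0_def)
    show "?\<gamma> C1_differentiable_on {0..1} - S0"
      unfolding C1_differentiable_on_def using E cont by (intro exI[of _ E]) (auto simp: S0_def)
    show "\<forall>t\<in>{0..1} - S0. vector_derivative ?\<gamma> (at t) \<noteq> 0"
    proof
      fix t assume t: "t \<in> {0..1} - S0"
      then obtain q where q: "q \<noteq> 0" "(rectpath lo hi has_vector_derivative q) (at t)"
        using rectpath_derivative[of lo hi t] by (auto simp: S0_def)
      have "vector_derivative ?\<gamma> (at t) = Complex (Re q) (Im q * Y (Re (rectpath lo hi t)) +
          Im (rectpath lo hi t) * (Y' (Re (rectpath lo hi t)) * Re q))"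
        using stretch_curve_derivative[OF q(2)] by (rule vector_derivative_at)
      \<comment> \<open>If Re q vanishes, the imaginary part reduces to Im q times \<open>Y\<close>,
        and then Im q is nonzero.\<close>
      then show "vector_derivative ?\<gamma> (at t) \<noteq> 0"
        using q(1) Y_pos[of "Re (rectpath lo hi t)"] by (auto simp: complex_eq_iff)
    qed
  qed
qed

lemma disk_region:
  assumes "z \<in> disk"
  shows "\<bar>Re z\<bar> < 1" "\<bar>Im z\<bar> \<le> Ye (Re z)" "z \<in> S"
proof -
  show 1: "\<bar>Re z\<bar> < 1" "\<bar>Im z\<bar> \<le> Ye (Re z)"
    using assms Y_less[of "Re z"] by (auto simp: disk_def)
  show "z \<in> S"
    using region[OF 1] by simp
qed

lemma inj_on_F: "inj_on F disk"
proof (rule inj_onI)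
  fix z w assume zw: "z \<in> disk" "w \<in> disk" and eq: "F z = F w"
  have "Re (W z) = Re (W w)" "Im (W z) = Im (W w)" and Re: "Re z = Re w"
    using eq by (auto simp: F_W vec_eq_iff forall_3 vector_3)
  then have Q: "Q z = Q w"
    by (simp add: Q_def complex_eq_iff)
  have zw': "Complex (Re w) (Im z) = z" "Complex (Re w) (Im w) = w"
    using Re by (simp_all add: complex_eq_iff)
  have "\<not> Im z < Im w" "\<not> Im w < Im z"
    using Re_Q_less[of "Re w" "Im z" "Im w"] Re_Q_less[of "Re w" "Im w" "Im z"]
      disk_region(1,2)[OF zw(1)] disk_region(1,2)[OF zw(2)] Q Re unfolding zw' by (fastforce simp: abs_le_iff)+
  then show "z = w"
    using Re by (simp add: complex_eq_iff)
qed

lemma compact_embedded_minimal_disk_F: "compact_embedded_minimal_disk disk F (F ` disk)"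
  unfolding compact_embedded_minimal_disk_def
  using closed_disk_domain_disk S smooth_on_F inj_on_F inj_frechet_derivative_F mean_curvature_F disk_region(3)
  by blast

lemma sff_norm_sq_at_F:
  "z \<in> disk \<Longrightarrow> sff_norm_sq_at disk F (F z) = 2 * (norm (h' z))\<^sup>2 / (cosh (v z)) ^ 4"
  by (simp add: sff_norm_sq_at_def inj_on_F sff_norm_sq_F disk_region(3))

lemma F_3 [simp]: "F z $ 3 = Re z"
  by (simp add: F_W vector_3)

lemma axis_in_disk: "\<bar>x\<bar> \<le> 1/2 \<Longrightarrow> Complex x 0 \<in> disk"
  using Y_pos[of x] by (simp add: disk_def)

lemma F_axis_disk: "\<bar>x\<bar> \<le> 1/2 \<Longrightarrow> F (Complex x 0) = vector [0, 0, x]"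
  by (rule F_axis) simp

lemma x3_segment_subset: "x3_segment (- 1/2) (1/2) \<subseteq> F ` disk"
proof
  fix p assume "p \<in> x3_segment (- 1/2) (1/2)"
  then obtain t where "p = vector [0, 0, t]" "\<bar>t\<bar> \<le> 1/2"
    by (auto simp: x3_segment_def abs_le_iff)
  then show "p \<in> F ` disk"
    using F_axis_disk axis_in_disk by (metis imageI)
qed

section \<open>Symmetry, curvature bounds and the radius of the slices\<close>

lemma norm_W_cnj: "z \<in> S \<Longrightarrow> norm (W (cnj z)) = norm (W z)"
  by (simp add: W_cnj)

text \<open>The half-turn carries the estimates from y \<ge> 0 to the other half.\<close>

lemma abs_Im_point:
  assumes "\<bar>Re z\<bar> < 1" "\<bar>Im z\<bar> \<le> Ye (Re z)"
  shows "norm (W (Complex (Re z) \<bar>Im z\<bar>)) = norm (W z)" "v (Complex (Re z) \<bar>Im z\<bar>) = \<bar>v z\<bar>"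
proof -
  have *: "z \<in> S" and x: "\<bar>Re z\<bar> < 1"
    using region[OF assms] assms by auto
  have "Complex (Re z) \<bar>Im z\<bar> = (if Im z \<ge> 0 then z else cnj z)"
    by (simp add: complex_eq_iff)
  then show "norm (W (Complex (Re z) \<bar>Im z\<bar>)) = norm (W z)"
    using norm_W_cnj[OF *] by simp
  have "0 \<le> v (Complex (Re z) \<bar>Im z\<bar>)"
    using v_pos[OF x, of "\<bar>Im z\<bar>"] v_axis[OF x] assms(2) by (cases "Im z = 0") auto
  moreover have "v (Complex (Re z) \<bar>Im z\<bar>) = v z \<or> v (Complex (Re z) \<bar>Im z\<bar>) = - v z"
    using h_cnj[OF *] \<open>Complex (Re z) \<bar>Im z\<bar> = _\<close> by simp
  ultimately show "v (Complex (Re z) \<bar>Im z\<bar>) = \<bar>v z\<bar>"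
    by linarith
qed

text \<open>Start from |A|^2 = 2 |h'|^2 / cosh^4 v and |h'| \<le> 2 f. The first bound drops the
  cosh. The second uses cosh v \<ge> sinh |v| \<ge> |W| f / 2, after which \<open>f\<close> cancels:
  away from the axis the curvature is controlled however large \<open>f\<close> is.\<close>

lemma curvature_bounds:
  assumes "z \<in> disk"
  shows "sff_norm_sq_at disk F (F z) \<le> 8 * (f (Re z))\<^sup>2"
    and "W z \<noteq> 0 \<Longrightarrow> sff_norm_sq_at disk F (F z) \<le> 32 / (norm (W z))\<^sup>2"
proof -
  note z = disk_region(1,2)[OF assms]
  let ?f = "f (Re z)" and ?C = "cosh (v z)"
  have "norm (h' z) \<le> 2 * ?f"
    using h'_upper[OF z] by simp
  then have "(norm (h' z))\<^sup>2 \<le> (2 * ?f)\<^sup>2"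
    by (intro power_mono) auto
  then have A: "sff_norm_sq_at disk F (F z) \<le> 8 * ?f\<^sup>2 / ?C ^ 4"
    unfolding sff_norm_sq_at_F[OF assms] by (intro divide_right_mono) (auto simp: power_mult_distrib)
  have C: "1 \<le> ?C"
    by (rule cosh_real_ge_1)
  then have "8 * ?f\<^sup>2 / ?C ^ 4 \<le> 8 * ?f\<^sup>2 / 1"
    by (intro divide_left_mono) (auto intro: one_le_power)
  with A show "sff_norm_sq_at disk F (F z) \<le> 8 * ?f\<^sup>2"
    by simp
  assume "W z \<noteq> 0"
  then have W: "0 < norm (W z)"
    by simp
  have "norm (W z) \<le> 2 * sinh \<bar>v z\<bar> / ?f"
    using norm_W_upper[OF z(1), of "\<bar>Im z\<bar>"] z(2) unfolding abs_Im_point[OF z] by simp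
  then have "norm (W z) * ?f / 2 \<le> sinh \<bar>v z\<bar>"
    using f_pos[of "Re z"] by (simp add: field_simps)
  also have "\<dots> \<le> cosh \<bar>v z\<bar>"
    using sinh_less_cosh_real less_imp_le by blast
  also have "\<dots> = ?C"
    by simp
  finally have "norm (W z) * ?f / 2 \<le> ?C" .
  then have "(norm (W z) * ?f / 2)\<^sup>2 \<le> ?C\<^sup>2"
    using f_pos[of "Re z"] by (intro power_mono) auto
  also have "\<dots> \<le> ?C ^ 4"
    using C by (intro power_increasing) auto
  finally have "8 * ?f\<^sup>2 / ?C ^ 4 \<le> 8 * ?f\<^sup>2 / (norm (W z) * ?f / 2)\<^sup>2"
    using W f_pos[of "Re z"] by (intro divide_left_mono) auto
  also have "\<dots> = 32 / (norm (W z))\<^sup>2"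
    using W f_pos[of "Re z"] by (simp add: field_simps power2_eq_square)
  finally show "sff_norm_sq_at disk F (F z) \<le> 32 / (norm (W z))\<^sup>2"
    using A by linarith
qed

definition radius :: "real \<Rightarrow> real" where
  "radius x = norm (W (Complex x (Y x)))"

lemma radius_ge: "\<bar>x\<bar> < 1 \<Longrightarrow> sinh (f x * Y x / 2) / (4 * f x) \<le> radius x"
  unfolding radius_def using norm_W_lower[of x "Y x"] Y_pos[of x] Y_less[of x] by simp

text \<open>Strictly between the faces of the slab only the curved sides |y| = Y(x) contribute; the
  straight sides of the parameter disk map to the faces.\<close>

lemma disk_boundary_point:
  assumes "p \<in> disk_boundary disk F" "- 1/2 < p$3" "p$3 < 1/2"
  shows "(p$1)\<^sup>2 + (p$2)\<^sup>2 = (radius (p$3))\<^sup>2"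
proof -
  obtain z where z: "z \<in> frontier disk" "p = F z"
    using assms(1) by (auto simp: disk_boundary_def)
  then have zd: "z \<in> disk" and p3: "p$3 = Re z" and Im: "\<bar>Im z\<bar> = Y (Re z)"
    using assms(2,3) by (auto simp: frontier_disk F_W vector_3)
  have "radius (p$3) = norm (W z)"
    using abs_Im_point(1)[OF disk_region(1,2)[OF zd]] by (simp add: radius_def p3 Im)
  then show ?thesis
    using z(2) by (simp add: F_W vector_3 cmod_power2)
qed

subsection \<open>Horizontal slices\<close>

definition slice_path :: "real \<Rightarrow> real \<Rightarrow> real^3" where
  "slice_path x s = F (Complex x (Y x * (2 * s - 1)))"

context
  fixes x :: real
  assumes x: "\<bar>x\<bar> \<le> 1/2"
begin

lemma slice_path_point: "s \<in> {0..1} \<Longrightarrow> Complex x (Y x * (2 * s - 1)) \<in> disk"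
proof -
  assume "s \<in> {0..1}"
  then have "\<bar>Y x * (2 * s - 1)\<bar> \<le> Y x * 1"
    unfolding abs_mult using Y_pos[of x] by (intro mult_mono) auto
  then show ?thesis
    using x by (simp add: disk_def)
qed

lemma arc_slice_path: "arc (slice_path x)"
  unfolding arc_def path_def
proof
  have F: "continuous_on S F"
    using F_derivative by (auto intro!: continuous_at_imp_continuous_on intro: has_derivative_continuous)
  have "(\<lambda>s. Complex x (Y x * (2 * s - 1))) = (\<lambda>s. of_real x + \<i> * of_real (Y x * (2 * s - 1)))"
    by (simp add: fun_eq_iff complex_eq_iff)
  then have "continuous_on {0..1} (\<lambda>s. Complex x (Y x * (2 * s - 1)))"
    by (auto intro!: continuous_intros)
  then show "continuous_on {0..1} (slice_path x)"
    unfolding slice_path_def using disk_region(3) slice_path_point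
    by (intro continuous_on_compose2[OF F]) auto
  show "inj_on (slice_path x) {0..1}"
  proof (rule inj_onI)
    fix s t :: real assume st: "s \<in> {0..1}" "t \<in> {0..1}" "slice_path x s = slice_path x t"
    then have "Complex x (Y x * (2 * s - 1)) = Complex x (Y x * (2 * t - 1))"
      unfolding slice_path_def using inj_onD[OF inj_on_F] slice_path_point by blast
    then show "s = t"
      using Y_pos[of x] by simp
  qed
qed

lemma path_image_slice_path: "path_image (slice_path x) = slice (F ` disk) x"
proof
  show "path_image (slice_path x) \<subseteq> slice (F ` disk) x"
    unfolding path_image_def slice_def slice_path_def using slice_path_point by auto
  show "slice (F ` disk) x \<subseteq> path_image (slice_path x)"
  proof
    fix p assume "p \<in> slice (F ` disk) x"
    then obtain z where z: "z \<in> disk" "p = F z" "Re z = x"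
      by (auto simp: slice_def)
    define s where "s = (Im z / Y x + 1) / 2"
    have "Complex x (Y x * (2 * s - 1)) = z"
      using z Y_pos[of x] by (simp add: s_def complex_eq_iff add_divide_distrib)
    moreover have "s \<in> {0..1}"
      using z Y_pos[of x] by (auto simp: s_def disk_def abs_le_iff divide_simps)
    ultimately show "p \<in> path_image (slice_path x)"
      unfolding path_image_def slice_path_def z(2) by force
  qed
qed

lemma is_arc_slice: "is_arc (slice (F ` disk) x)"
  using arc_slice_path path_image_slice_path is_arc_def by blast

lemma arc_endpoints_slice: "arc_endpoints (slice (F ` disk) x) = {F (Complex x (- Y x)), F (Complex x (Y x))}"
  using arc_endpoints_path_image[OF arc_slice_path] path_image_slice_path
  by (simp add: pathstart_def pathfinish_def slice_path_def)

lemma arc_endpoints_slice_boundary: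
  assumes "- 1/2 < x" "x < 1/2"
  shows "arc_endpoints (slice (F ` disk) x) = {p \<in> disk_boundary disk F. p$3 = x}"
proof -
  have "{z \<in> frontier disk. Re z = x} = {Complex x (- Y x), Complex x (Y x)}"
    using assms Y_pos[of x] unfolding frontier_disk by (auto simp: disk_def complex_eq_iff)
  moreover have "{p \<in> disk_boundary disk F. p$3 = x} = F ` {z \<in> frontier disk. Re z = x}"
    by (auto simp: disk_boundary_def)
  ultimately show ?thesis
    by (simp add: arc_endpoints_slice)
qed

lemma radius_le_setdist: "radius x \<le> setdist x3_axis (arc_endpoints (slice (F ` disk) x))"
proof (rule le_setdistI)
  have "0 \<in> x3_axis"
    by (simp add: x3_axis_def)
  then show "x3_axis \<noteq> {}"
    by blast
  show "arc_endpoints (slice (F ` disk) x) \<noteq> {}"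
    by (simp add: arc_endpoints_slice)
  fix a p assume a: "a \<in> x3_axis" and p: "p \<in> arc_endpoints (slice (F ` disk) x)"
  obtain y where y: "\<bar>y\<bar> = Y x" "p = F (Complex x y)"
  proof -
    have "p = F (Complex x (- Y x)) \<or> p = F (Complex x (Y x))"
      using p by (simp add: arc_endpoints_slice)
    then show ?thesis
      using that[of "Y x"] that[of "- Y x"] Y_pos[of x] by fastforce
  qed
  have "radius x = norm (W (Complex x y))"
    using abs_Im_point(1)[of "Complex x y"] x y Y_less[of x] by (simp add: radius_def)
  also have "\<dots> = sqrt ((p$1)\<^sup>2 + (p$2)\<^sup>2)"
    using y by (simp add: F_W vector_3 cmod_def)
  also have "\<dots> \<le> sqrt ((p$1)\<^sup>2 + (p$2)\<^sup>2 + (a$3 - p$3)\<^sup>2)"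
    by simp
  also have "\<dots> = dist a p"
    using a by (simp add: dist_norm norm_vec_def L2_set_def sum_3 x3_axis_def)
  finally show "radius x \<le> dist a p" .
qed

end

subsection \<open>The two multi-valued graphs\<close>

definition half_disk :: "complex set" where
  "half_disk = {z \<in> disk. 0 < Im z}"

text \<open>On the disk v \<le> 2 f Y, so the radius bound 2 sinh v / f falls under \<open>T\<close>
  by \<open>T_lower\<close>.\<close>

lemma half_disk_subset: "half_disk \<subseteq> graph_region"
proof
  fix z assume z: "z \<in> half_disk"
  have x: "\<bar>Re z\<bar> < 1" and y: "0 < Im z" "Im z \<le> Y (Re z)"
    using z by (auto simp: half_disk_def disk_def)
  have y': "0 \<le> Im z" "Im z < Ye (Re z)"
    using y Y_less[of "Re z"] by auto
  have "norm (W z) \<le> 2 * sinh (v z) / f (Re z)"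
    using norm_W_upper[OF x, of "Im z"] y' by simp
  also have "\<dots> \<le> 2 * sinh (2 * f (Re z) * Y (Re z)) / f (Re z)"
  proof -
    have "v z \<le> 2 * f (Re z) * Im z"
      using v_bounds(2)[OF x, of "Im z"] y' by simp
    also have "\<dots> \<le> 2 * f (Re z) * Y (Re z)"
      using y f_pos[of "Re z"] by (intro mult_left_mono) auto
    finally show ?thesis
      using f_pos[of "Re z"] by (intro divide_right_mono) auto
  qed
  also have "\<dots> < T (Re z)"
    by (rule T_lower[OF x])
  finally show "z \<in> graph_region"
    using x y y' by (simp add: graph_region_def half_plane_def)
qed

text \<open>The rotation \<open>cis c\<close> lets one argument serve both halves. The domain of the
  graph is the polar image of the half disk; the image of the stretched open rectangle is open,
  connected and dense in it.\<close>

lemma multivalued_graph_rotated: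
  "multivalued_graph ((\<lambda>z. vector [Re (cis c * W z), Im (cis c * W z), Re z]) ` half_disk)"
  unfolding multivalued_graph_def
proof (intro exI conjI)
  let ?B = "stretch ` box (Complex (- 1/2) 0) hi"
  let ?D = "polar c ` half_disk" and ?u = "\<lambda>w. Re (polar_inv c w)"
  have hd: "half_disk = stretch ` {z. \<bar>Re z\<bar> \<le> 1/2 \<and> 0 < Im z \<and> Im z \<le> 1}"
    unfolding stretch_image half_disk_def disk_def unstretch_def using Y_pos
    by (auto simp: divide_simps abs_le_iff)
  have B: "?B \<subseteq> half_disk"
    unfolding hd by (intro image_mono) (auto simp: in_box_complex_iff)
  have "half_disk \<subseteq> stretch ` cbox (Complex (- 1/2) 0) hi"
    unfolding hd by (intro image_mono) (auto simp: in_cbox_complex_iff)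
  also have "\<dots> \<subseteq> closure ?B"
    by (intro image_subset_closure_image continuous_on_stretch box_subset_cbox)
      (simp add: closure_box box_ne_empty Basis_complex_def)
  finally have cl: "half_disk \<subseteq> closure ?B" .
  have "polar c ` half_disk \<subseteq> closure (polar c ` ?B)"
    using half_disk_subset B cl
    by (intro image_subset_closure_image continuous_on_subset[OF continuous_on_polar]) (auto simp: graph_region_def)
  moreover have "open (polar c ` ?B)"
  proof (rule polar_image_open)
    show "open ?B"
      using homeomorphism_imp_open_map[OF homeomorphism_stretch] by (simp add: open_box flip: open_openin)
    show "?B \<subseteq> graph_region"
      using B half_disk_subset by blast
  qed
  moreover have "connected (polar c ` ?B)"
    using B half_disk_subset
    by (intro connected_continuous_image continuous_on_stretch continuous_on_subset[OF continuous_on_polar] convex_connected)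
      (auto simp: graph_region_def)
  moreover have "polar c ` ?B \<noteq> {}"
    by (simp add: box_ne_empty Basis_complex_def)
  moreover have "?D \<subseteq> {0<..} \<times> UNIV"
    by (auto simp: polar_def)
  ultimately show "polar_domain ?D"
    unfolding polar_domain_def by (intro conjI exI[of _ "polar c ` ?B"] image_mono B)
  have sub: "?D \<subseteq> polar c ` graph_region"
    using half_disk_subset by blast
  have "Ck_on 0 (polar c ` graph_region) ?u"
    using smooth_on_height unfolding smooth_on_def by blast
  then show "continuous_on ?D ?u"
    using sub continuous_on_subset by auto
  show "smooth_on (interior ?D) ?u"
    using smooth_on_height sub interior_subset by (meson smooth_on_subset subset_trans)
  show "(\<lambda>z. vector [Re (cis c * W z), Im (cis c * W z), Re z]) ` half_disk =
      (\<lambda>(\<rho>, \<theta>). vector [\<rho> * cos \<theta>, \<rho> * sin \<theta>, ?u (\<rho>, \<theta>)] :: real^3) ` ?D"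
    unfolding image_image
  proof (rule image_cong[OF refl])
    fix z assume "z \<in> half_disk"
    then have z: "z \<in> graph_region" "z \<in> half_plane"
      using half_disk_subset by (auto simp: graph_region_def)
    have "cis c * W z = fst (polar c z) *\<^sub>R cis (snd (polar c z))"
      by (rule W_polar[OF z(2)])
    then show "vector [Re (cis c * W z), Im (cis c * W z), Re z] =
        (case polar c z of (\<rho>, \<theta>) \<Rightarrow> (vector [\<rho> * cos \<theta>, \<rho> * sin \<theta>, ?u (\<rho>, \<theta>)] :: real^3))"
      using polar_inv_polar[OF z(1), of c] by (cases "polar c z") simp
  qed
qed

lemma two_multivalued_graphs:
  "\<exists>M1 M2. multivalued_graph M1 \<and> multivalued_graph M2 \<and> F ` disk - x3_segment (- 1/2) (1/2) = M1 \<union> M2"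
proof (intro exI conjI)
  let ?M = "\<lambda>c. (\<lambda>z. vector [Re (cis c * W z), Im (cis c * W z), Re z] :: real^3) ` half_disk"
  show "multivalued_graph (?M 0)" "multivalued_graph (?M pi)"
    by (rule multivalued_graph_rotated)+
  have upper: "?M 0 = F ` half_disk"
    by (simp add: F_W)
  \<comment> \<open>Multiplication by cis pi = -1 is the half-turn, which \<open>W_cnj\<close>
    identifies with conjugating the parameter.\<close>
  have "(vector [Re (cis pi * W z), Im (cis pi * W z), Re z] :: real^3) = F (cnj z)" if "z \<in> half_disk" for z
    using W_cnj[of z] disk_region(3)[of z] that by (simp add: F_W half_disk_def)
  then have lower: "?M pi = F ` cnj ` half_disk"
    unfolding image_image by (intro image_cong) auto
  have disk: "disk - {z. Im z = 0} = half_disk \<union> cnj ` half_disk"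
  proof (intro equalityI subsetI)
    fix z assume "z \<in> disk - {z. Im z = 0}"
    then have "z \<in> half_disk \<or> cnj z \<in> half_disk"
      by (auto simp: half_disk_def disk_def)
    then show "z \<in> half_disk \<union> cnj ` half_disk"
      by (metis UnI1 UnI2 complex_cnj_cnj imageI)
  qed (auto simp: half_disk_def disk_def)
  have seg: "x3_segment (- 1/2) (1/2) = F ` (disk \<inter> {z. Im z = 0})"
  proof -
    have "disk \<inter> {z. Im z = 0} = (\<lambda>x. Complex x 0) ` {- 1/2..1/2}"
      using Y_pos by (auto simp: disk_def image_iff complex_eq_iff abs_le_iff less_imp_le)
    then have "F ` (disk \<inter> {z. Im z = 0}) = (\<lambda>x. vector [0, 0, x]) ` {- 1/2..1/2}"
      unfolding image_image using F_axis_disk by (auto simp: image_image abs_le_iff intro!: image_cong)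
    then show ?thesis
      unfolding x3_segment_def image_def by auto
  qed
  have "F ` disk - x3_segment (- 1/2) (1/2) = F ` (disk - disk \<inter> {z. Im z = 0})"
    unfolding seg using inj_on_F by (intro inj_on_image_set_diff[symmetric]) auto
  also have "disk - disk \<inter> {z. Im z = 0} = half_disk \<union> cnj ` half_disk"
    using disk by auto
  finally show "F ` disk - x3_segment (- 1/2) (1/2) = ?M 0 \<union> ?M pi"
    unfolding upper lower by (simp add: image_Un)
qed

end

section \<open>The Weierstrass data\<close>

text \<open>The plane cut along the imaginary axis from id upwards and from -id downwards. There z^2
  + d^2 avoids the branch cut of \<open>csqrt\<close>; the set is starlike about 0, so primitives
  exist.\<close>

definition slit_plane :: "real \<Rightarrow> complex set" where
  "slit_plane d = {z. Re z \<noteq> 0 \<or> \<bar>Im z\<bar> < d}"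

definition smooth_abs :: "real \<Rightarrow> complex \<Rightarrow> complex" where
  "smooth_abs d z = csqrt (z\<^sup>2 + of_real (d\<^sup>2))"

text \<open>A holomorphic smoothing, at scale \<open>d\<close>, of twice the positive part of \<open>x\<close>.\<close>

definition ramp :: "real \<Rightarrow> complex \<Rightarrow> complex" where
  "ramp d z = z + smooth_abs d z"

text \<open>The constants of the introduction are \<open>\<Lambda> = 256000\<close> and \<open>c = 1/25600\<close>. Then \<open>20 \<Lambda> (8c)\<^sup>2 = 1/2\<close>
  bounds the rotation of a slice in the larger region, and \<open>\<Lambda>c = 10\<close> is large enough for \<open>barrier\<close> to
  separate the radii of the two regions.\<close>

definition real_ramp :: "real \<Rightarrow> real \<Rightarrow> real" where
  "real_ramp d x = x + sqrt (x\<^sup>2 + d\<^sup>2)"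

text \<open>The primitive of 256000 / p^3, where p is the ramp: since dp/dz = 2 p^2 / (p^2 + d^2),
  it comes from integrating 128000 (p^-3 + d^2 p^-5) in p.\<close>

definition height_map :: "real \<Rightarrow> complex \<Rightarrow> complex" where
  "height_map d z = - 64000 / ramp d z ^ 2 - 32000 * of_real (d\<^sup>2) / ramp d z ^ 4"

definition height_deriv :: "real \<Rightarrow> complex \<Rightarrow> complex" where
  "height_deriv d z = 256000 / ramp d z ^ 3"

definition speed :: "real \<Rightarrow> real \<Rightarrow> real" where
  "speed d x = 256000 / real_ramp d x ^ 3"

definition width :: "real \<Rightarrow> real \<Rightarrow> real" where
  "width d x = real_ramp d x ^ 2 / 25600"

definition width_deriv :: "real \<Rightarrow> real \<Rightarrow> real" where
  "width_deriv d x = real_ramp d x * (1 + x / sqrt (x\<^sup>2 + d\<^sup>2)) / 12800"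

definition outer_width :: "real \<Rightarrow> real \<Rightarrow> real" where
  "outer_width d x = real_ramp d x ^ 2 / 3200"

text \<open>With p the real ramp, 20 / p is 2 f Y, the bound for v in the disk, and 27/256000 bounds
  1/f because p \<le> 3 for |x| < 1. It decreases in x since p increases.\<close>

definition barrier :: "real \<Rightarrow> real \<Rightarrow> real" where
  "barrier d x = 27 / 256000 * exp (20 / real_ramp d x)"

context
  fixes d :: real
  assumes d: "0 < d" "d \<le> 1"
begin

lemma sqrt_pos: "0 < sqrt (x\<^sup>2 + d\<^sup>2)"
  using d by (simp add: add_nonneg_pos)

lemma real_ramp_pos: "0 < real_ramp d x"
proof -
  have "\<bar>x\<bar> < sqrt (x\<^sup>2 + d\<^sup>2)"
    using d by (intro real_less_rsqrt) simp
  then show ?thesis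
    by (simp add: real_ramp_def)
qed

lemma real_ramp_le: "\<bar>x\<bar> < 1 \<Longrightarrow> real_ramp d x \<le> 3"
proof -
  assume x: "\<bar>x\<bar> < 1"
  have "sqrt (x\<^sup>2 + d\<^sup>2) \<le> \<bar>x\<bar> + \<bar>d\<bar>"
    by (rule sqrt_sum_squares_le_sum_abs)
  with x d show ?thesis
    by (simp add: real_ramp_def)
qed

lemma real_ramp_le_nonpos: "x \<le> 0 \<Longrightarrow> real_ramp d x \<le> d"
  using sqrt_sum_squares_le_sum_abs[of x d] d by (simp add: real_ramp_def)

lemma le_real_ramp: "x \<le> real_ramp d x"
  using sqrt_pos[of x] by (simp add: real_ramp_def)

lemma real_ramp_le_sqrt: "real_ramp d x \<le> 2 * sqrt (x\<^sup>2 + d\<^sup>2)"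
  using real_le_rsqrt[of x "x\<^sup>2 + d\<^sup>2"] by (simp add: real_ramp_def)

lemma real_ramp_mono: "x \<le> y \<Longrightarrow> real_ramp d x \<le> real_ramp d y"
proof -
  assume "x \<le> y"
  have "norm (Complex x d) \<le> norm (Complex y d) + norm (Complex (x - y) 0)"
    using norm_triangle_ineq[of "Complex y d" "Complex (x - y) 0"] by (simp add: plus_complex.ctr)
  then show ?thesis
    using \<open>x \<le> y\<close> by (simp add: real_ramp_def cmod_def)
qed

lemma continuous_on_real_ramp: "continuous_on A (real_ramp d)"
  unfolding real_ramp_def by (intro continuous_intros)

lemma open_slit_plane: "open (slit_plane d)"
  unfolding slit_plane_def by (intro open_Collect_disj open_Collect_neq open_Collect_less continuous_intros)

lemma starlike_slit_plane: "starlike (slit_plane d)"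
  unfolding starlike_def
proof (intro bexI[of _ 0] ballI subsetI)
  show "0 \<in> slit_plane d"
    using d by (simp add: slit_plane_def)
  fix z w assume z: "z \<in> slit_plane d" and "w \<in> closed_segment 0 z"
  then obtain t where t: "0 \<le> t" "t \<le> 1" "w = t *\<^sub>R z"
    by (auto simp: in_segment)
  then have "\<bar>Im w\<bar> \<le> \<bar>Im z\<bar>"
    by (simp add: abs_mult mult_left_le_one_le)
  then show "w \<in> slit_plane d"
    using z t d by (cases "t = 0") (auto simp: slit_plane_def)
qed

lemma smooth_abs_domain:
  assumes "z \<in> slit_plane d"
  shows "z\<^sup>2 + of_real (d\<^sup>2) \<notin> \<real>\<^sub>\<le>\<^sub>0"
proof
  assume "z\<^sup>2 + of_real (d\<^sup>2) \<in> \<real>\<^sub>\<le>\<^sub>0"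
  then have *: "(Re z)\<^sup>2 - (Im z)\<^sup>2 + d\<^sup>2 \<le> 0" "Re z = 0 \<or> Im z = 0"
    by (auto simp: complex_nonpos_Reals_iff Re_power2 Im_power2)
  show False
  proof (cases "Re z = 0")
    case True
    then have "\<bar>Im z\<bar> < d" "d\<^sup>2 \<le> (Im z)\<^sup>2"
      using assms * by (auto simp: slit_plane_def)
    then show False
      using power_strict_mono[of "\<bar>Im z\<bar>" d 2] by simp
  next
    case False
    with * have "(Re z)\<^sup>2 + d\<^sup>2 \<le> 0"
      by simp
    then show False
      using zero_le_power2[of "Re z"] zero_less_power[OF d(1), of 2] by linarith
  qed
qed

lemma smooth_abs_sq: "(smooth_abs d z)\<^sup>2 = z\<^sup>2 + of_real (d\<^sup>2)"
  by (simp add: smooth_abs_def)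

lemma smooth_abs_of_real: "smooth_abs d (of_real x) = of_real (sqrt (x\<^sup>2 + d\<^sup>2))"
  unfolding smooth_abs_def by (simp flip: of_real_power of_real_add)

lemma ramp_of_real: "ramp d (of_real x) = of_real (real_ramp d x)"
  by (simp add: ramp_def real_ramp_def smooth_abs_of_real)

lemma ramp_nz: "ramp d z \<noteq> 0"
proof
  assume "ramp d z = 0"
  moreover have "ramp d z * (smooth_abs d z - z) = of_real (d\<^sup>2)"
    using smooth_abs_sq[of z] by (simp add: ramp_def power2_eq_square algebra_simps)
  ultimately show False
    using d by simp
qed

lemma smooth_abs_nz: "z \<in> slit_plane d \<Longrightarrow> smooth_abs d z \<noteq> 0"
  using smooth_abs_domain[of z] unfolding smooth_abs_def by auto

lemma ramp_derivative:
  assumes "z \<in> slit_plane d"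
  shows "(ramp d has_field_derivative ramp d z / smooth_abs d z) (at z)"
proof -
  have "(ramp d has_field_derivative 1 + (2 * z) / (2 * smooth_abs d z)) (at z)"
    unfolding ramp_def[abs_def] smooth_abs_def
    by (auto intro!: derivative_eq_intros smooth_abs_domain[OF assms, unfolded of_real_power])
  also have "1 + (2 * z) / (2 * smooth_abs d z) = ramp d z / smooth_abs d z"
    using smooth_abs_nz[OF assms] by (simp add: ramp_def field_simps)
  finally show ?thesis .
qed

lemma height_map_derivative:
  assumes "z \<in> slit_plane d"
  shows "(height_map d has_field_derivative height_deriv d z) (at z)"
proof -
  let ?p = "ramp d z" and ?q = "smooth_abs d z"
  have nz: "?p \<noteq> 0" "?q \<noteq> 0"
    using ramp_nz smooth_abs_nz[OF assms] by auto
  have pq: "?p\<^sup>2 + of_real (d\<^sup>2) = 2 * ?p * ?q"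
    using smooth_abs_sq[of z] by (simp add: ramp_def power2_eq_square algebra_simps)
  have "((\<lambda>w. - 64000 / w ^ 2 - 32000 * of_real (d\<^sup>2) / w ^ 4) has_field_derivative
      128000 / w ^ 3 + 128000 * of_real (d\<^sup>2) / w ^ 5) (at w)" if "w \<noteq> 0" for w :: complex
    using that by (auto intro!: derivative_eq_intros) (simp add: divide_simps eval_nat_numeral)
  from DERIV_chain2[OF this[OF nz(1)] ramp_derivative[OF assms]]
  have "(height_map d has_field_derivative
    (128000 / ?p ^ 3 + 128000 * of_real (d\<^sup>2) / ?p ^ 5) * (?p / ?q)) (at z)"
    unfolding height_map_def[abs_def] .
  also have "(128000 / ?p ^ 3 + 128000 * of_real (d\<^sup>2) / ?p ^ 5) * (?p / ?q) =
      128000 * (?p\<^sup>2 + of_real (d\<^sup>2)) / (?p ^ 4 * ?q)"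
    using nz by (simp add: divide_simps eval_nat_numeral)
  also have "\<dots> = height_deriv d z"
    unfolding pq height_deriv_def using nz by (simp add: divide_simps eval_nat_numeral)
  finally show ?thesis .
qed

lemma height_map_cnj:
  assumes "z \<in> slit_plane d"
  shows "height_map d (cnj z) = cnj (height_map d z)"
proof -
  have "smooth_abs d (cnj z) = cnj (smooth_abs d z)"
    using cnj_csqrt[OF smooth_abs_domain[OF assms]] by (simp add: smooth_abs_def)
  then have "ramp d (cnj z) = cnj (ramp d z)"
    by (simp add: ramp_def)
  then show ?thesis
    by (simp add: height_map_def)
qed

section \<open>Deviation of the data from their values on the axis, inside the larger region\<close>

context
  fixes x y :: real
  assumes x: "\<bar>x\<bar> < 1" and y: "\<bar>y\<bar> \<le> outer_width d x"
begin

lemma y_le: "\<bar>y\<bar> \<le> 3 / 3200 * real_ramp d x"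
proof -
  have "real_ramp d x * real_ramp d x \<le> 3 * real_ramp d x"
    using real_ramp_le[OF x] real_ramp_pos[of x] by (intro mult_right_mono) auto
  with y show ?thesis
    by (simp add: outer_width_def power2_eq_square)
qed

lemma point_in_slit_plane: "Complex x y \<in> slit_plane d"
proof (cases "x = 0")
  case True
  then have "real_ramp d x = d"
    using d by (simp add: real_ramp_def)
  then show ?thesis
    using y_le d by (simp add: slit_plane_def)
qed (simp add: slit_plane_def)

text \<open>With q = \<open>smooth_abs\<close> and s its axis value, |q - s| |q + s| = |q^2 - s^2|
  \<le> 3 |y| s, while Re q \<ge> 0 gives |q + s| \<ge> s. The summand z contributes the fourth
  |y|.\<close>

lemma ramp_diff: "norm (ramp d (Complex x y) - of_real (real_ramp d x)) \<le> 4 * \<bar>y\<bar>"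
proof -
  define s where "s = sqrt (x\<^sup>2 + d\<^sup>2)"
  let ?z = "Complex x y" and ?q = "smooth_abs d (Complex x y)"
  have s: "0 < s" "\<bar>x\<bar> \<le> s" "\<bar>y\<bar> \<le> s"
    using sqrt_pos[of x] real_ramp_le_sqrt[of x] y_le by (auto simp: s_def intro: real_le_rsqrt)
  have s2: "s\<^sup>2 = x\<^sup>2 + d\<^sup>2"
    by (simp add: s_def)
  have "0 \<le> Re ?q"
    using csqrt_principal[of "?z\<^sup>2 + of_real (d\<^sup>2)"] unfolding smooth_abs_def by auto
  then have "s \<le> Re (?q + of_real s)"
    by simp
  also have "\<dots> \<le> norm (?q + of_real s)"
    by (rule complex_Re_le_cmod)
  finally have "norm (?q - of_real s) * s \<le> norm (?q - of_real s) * norm (?q + of_real s)"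
    by (intro mult_left_mono) auto
  also have "\<dots> = norm (?q\<^sup>2 - (of_real s)\<^sup>2)"
    by (simp add: power2_eq_square algebra_simps flip: norm_mult)
  also have "?q\<^sup>2 - (of_real s)\<^sup>2 = of_real y * Complex (- y) (2 * x)"
    unfolding smooth_abs_sq of_real_power[symmetric] s2 by (simp add: complex_eq_iff power2_eq_square)
  also have "norm \<dots> \<le> \<bar>y\<bar> * (\<bar>y\<bar> + \<bar>2 * x\<bar>)"
    unfolding norm_mult using cmod_le[of "Complex (- y) (2 * x)"] by (intro mult_mono) auto
  also have "\<dots> \<le> \<bar>y\<bar> * (3 * s)"
    using s by (intro mult_left_mono) auto
  finally have "norm (?q - of_real s) \<le> 3 * \<bar>y\<bar>"
    using s(1) by (simp add: algebra_simps) 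
  moreover have "ramp d ?z - of_real (real_ramp d x) = (?q - of_real s) + \<i> * of_real y"
    by (simp add: ramp_def real_ramp_def s_def complex_eq_iff)
  ultimately show ?thesis
    using norm_triangle_ineq[of "?q - of_real s" "\<i> * of_real y"] by (simp add: norm_mult)
qed

text \<open>\<open>w\<close> is the ramp relative to its axis value. It stays within 1/10 of 1,
  where |w^-3 - 1| \<le> (331/100) / (729/1000) |w - 1| \<le> 5 |w - 1|. The factor 20 is 5 times
  the 4 of \<open>ramp_diff\<close>.\<close>

lemma height_deriv_diff:
  "norm (height_deriv d (Complex x y) - of_real (speed d x)) \<le> 20 * \<bar>y\<bar> * speed d x / real_ramp d x"
proof -
  define r where "r = real_ramp d x"
  define w where "w = ramp d (Complex x y) / of_real r"
  define e where "e = 4 * \<bar>y\<bar> / r"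
  have r: "0 < r"
    by (simp add: r_def real_ramp_pos)
  have "norm (w - 1) = norm (ramp d (Complex x y) - of_real r) / r"
  proof -
    have "w - 1 = (ramp d (Complex x y) - of_real r) / of_real r"
      using r by (simp add: w_def field_simps)
    then show ?thesis
      using r by (simp add: norm_divide)
  qed
  also have "\<dots> \<le> e"
    using ramp_diff r by (simp add: e_def r_def divide_right_mono)
  finally have we: "norm (w - 1) \<le> e" .
  have e: "0 \<le> e" "e \<le> 1/10"
    using y_le r by (auto simp: e_def r_def field_simps)
  have w1: "norm w \<le> 11/10" "9/10 \<le> norm w"
    using we e norm_triangle_ineq[of "w - 1" 1] norm_triangle_ineq2[of 1 "1 - w"] by (auto simp: norm_minus_commute)
  have "norm (1 + w + w\<^sup>2) \<le> 1 + norm w + (norm w)\<^sup>2"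
    by (metis norm_add_rule_thm norm_one norm_power norm_triangle_ineq order_refl)
  also have "\<dots> \<le> 1 + 11/10 + (11/10)\<^sup>2"
    using w1 by (intro add_mono power_mono) auto
  finally have 1: "norm (1 + w + w\<^sup>2) \<le> 331/100"
    by (simp add: power2_eq_square)
  have "(9/10) ^ 3 \<le> norm w ^ 3"
    using w1 by (intro power_mono) auto
  then have 2: "729/1000 \<le> norm (w ^ 3)"
    by (simp add: norm_power power_divide)
  have wnz: "w \<noteq> 0"
    using w1 by auto
  have "norm (1 / w ^ 3 - 1) = norm (w - 1) * norm (1 + w + w\<^sup>2) / norm (w ^ 3)"
  proof -
    have "1 / w ^ 3 - 1 = - ((w - 1) * (1 + w + w\<^sup>2) / w ^ 3)"
      using wnz by (simp add: field_simps power2_eq_square power3_eq_cube)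
    then show ?thesis
      by (simp add: norm_mult norm_divide)
  qed
  also have "\<dots> \<le> e * (331/100) / (729/1000)"
    using we 1 2 e by (intro frac_le mult_mono) auto
  also have "\<dots> \<le> 5 * e"
    using e by simp
  finally have "norm (1 / w ^ 3 - 1) \<le> 5 * e" .
  moreover have "height_deriv d (Complex x y) - of_real (speed d x) = of_real (speed d x) * (1 / w ^ 3 - 1)"
    using r ramp_nz by (simp add: height_deriv_def speed_def w_def field_simps flip: r_def)
  moreover have "0 < speed d x"
    using r by (simp add: speed_def r_def)
  ultimately have "norm (height_deriv d (Complex x y) - of_real (speed d x)) \<le> speed d x * (5 * e)"
    by (simp add: norm_mult)
  then show ?thesis
    by (simp add: e_def r_def mult_ac)
qed

lemma height_deriv_close: "norm (height_deriv d (Complex x y) - of_real (speed d x)) \<le> speed d x / 2"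
proof -
  have "20 * \<bar>y\<bar> / real_ramp d x \<le> 1/2"
    using y_le real_ramp_pos[of x] by (simp add: field_simps)
  then have "speed d x * (20 * \<bar>y\<bar> / real_ramp d x) \<le> speed d x * (1/2)"
    using real_ramp_pos[of x] by (intro mult_left_mono) (auto simp: speed_def)
  moreover have "20 * \<bar>y\<bar> * speed d x / real_ramp d x = speed d x * (20 * \<bar>y\<bar> / real_ramp d x)"
    by simp
  ultimately show ?thesis
    using height_deriv_diff by linarith
qed

end

text \<open>The axis value of h' is real, so the y-derivative of u is at most 20 |y| f / p in size,
  with p the real ramp. After multiplication by |y|, the bound |y| \<le> p^2 / 3200 makes all powers
  of p cancel and leaves exactly 1/2.\<close>

lemma height_map_rotation:
  assumes x: "\<bar>x\<bar> < 1" and y: "\<bar>y\<bar> \<le> outer_width d x"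
  shows "\<bar>Re (height_map d (Complex x y)) - Re (height_map d (Complex x 0))\<bar> \<le> 1/2"
proof -
  define r where "r = real_ramp d x"
  have r: "0 < r"
    by (simp add: r_def real_ramp_pos)
  have s: "0 < speed d x"
    using r by (simp add: speed_def r_def)
  let ?B = "20 * \<bar>y\<bar> * speed d x / r"
  have "norm (Re (height_map d (Complex x y)) - Re (height_map d (Complex x 0))) \<le> ?B * norm (y - 0)"
  proof (rule field_differentiable_bound[of "{- \<bar>y\<bar>..\<bar>y\<bar>}"])
    fix t assume "t \<in> {- \<bar>y\<bar>..\<bar>y\<bar>}"
    then have ty: "\<bar>t\<bar> \<le> \<bar>y\<bar>" and t: "\<bar>t\<bar> \<le> outer_width d x"
      using y by auto
    have line: "(Complex x has_derivative (\<lambda>k. \<i> * of_real k)) (at t)"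
    proof -
      have "Complex x = (\<lambda>t. of_real x + \<i> * of_real t)"
        by (simp add: fun_eq_iff complex_eq_iff)
      then show ?thesis
        by (auto intro!: derivative_eq_intros)
    qed
    have "((\<lambda>t. Re (height_map d (Complex x t))) has_derivative
        (\<lambda>k. Re (height_deriv d (Complex x t) * (\<i> * of_real k)))) (at t)"
      by (rule has_derivative_Re[OF has_derivative_compose[OF line has_field_derivative_imp_has_derivative[OF
              height_map_derivative[OF point_in_slit_plane[OF x t]]]]])
    also have "(\<lambda>k. Re (height_deriv d (Complex x t) * (\<i> * of_real k))) = (*) (- Im (height_deriv d (Complex x t)))"
      by (simp add: fun_eq_iff)
    finally show "((\<lambda>t. Re (height_map d (Complex x t))) has_field_derivative - Im (height_deriv d (Complex x t)))
        (at t within {- \<bar>y\<bar>..\<bar>y\<bar>})"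
      unfolding has_field_derivative_def by (rule has_derivative_at_withinI)
    have "\<bar>Im (height_deriv d (Complex x t) - of_real (speed d x))\<bar> \<le> 20 * \<bar>t\<bar> * speed d x / r"
      using height_deriv_diff[OF x t] abs_Im_le_cmod order_trans unfolding r_def by blast
    also have "\<dots> \<le> ?B"
      using ty r s by (intro divide_right_mono mult_right_mono) auto
    finally show "norm (- Im (height_deriv d (Complex x t))) \<le> ?B"
      by simp
  qed auto
  also have "?B * norm (y - 0) = 20 * \<bar>y\<bar>\<^sup>2 * speed d x / r"
    by (simp add: power2_eq_square)
  also have "\<dots> \<le> 20 * (outer_width d x)\<^sup>2 * speed d x / r"
    using y r s by (intro divide_right_mono mult_right_mono mult_left_mono power_mono) auto
  also have "\<dots> = 1/2"
    using r by (simp add: outer_width_def speed_def field_simps eval_nat_numeral flip: r_def)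
  finally show ?thesis
    by simp
qed

section \<open>Exponential inequalities that separate the radii of the two regions\<close>

lemma exp_ge_cube: "0 \<le> t \<Longrightarrow> (t / 3) ^ 3 \<le> exp t" for t :: real
proof -
  assume t: "0 \<le> t"
  have "t / 3 \<le> exp (t / 3)"
    using exp_ge_add_one_self[of "t / 3"] by linarith
  then have "(t / 3) ^ 3 \<le> exp (t / 3) ^ 3"
    using t by (intro power_mono) auto
  also have "\<dots> = exp t"
    by (simp flip: exp_of_nat_mult)
  finally show ?thesis .
qed

text \<open>The fourth power outweighs the factor p^3 in 1/f by one, which leaves a radius of order
  1/p. Expanding (1 + t/4)^4 \<le> exp t leaves a term 1 to absorb exp(-t).\<close>

lemma sinh_ge_power4: "0 \<le> t \<Longrightarrow> t ^ 4 / 512 \<le> sinh t" for t :: real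
proof -
  assume t: "0 \<le> t"
  have "(1 + s) ^ 4 = 1 + s ^ 4 + (4 * s + 6 * s\<^sup>2 + 4 * s ^ 3)" for s :: real
    by (simp add: eval_nat_numeral algebra_simps)
  from this[of "t / 4"] have "1 + (t / 4) ^ 4 \<le> (1 + t / 4) ^ 4"
    using t by simp
  also have "\<dots> \<le> exp (t / 4) ^ 4"
    using t by (intro power_mono) auto
  also have "\<dots> = exp t"
    by (simp flip: exp_of_nat_mult)
  finally have "1 + t ^ 4 / 256 \<le> exp t"
    by (simp add: power_divide)
  moreover have "exp (- t) \<le> 1"
    using t by simp
  moreover have "a / 512 \<le> (b - c) / 2" if "1 + a / 256 \<le> b" "c \<le> 1" for a b c :: real
    using that by (simp add: field_simps)
  ultimately show ?thesis
    unfolding sinh_field_def by blast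
qed

lemma barrier_lower:
  assumes "\<bar>x\<bar> < 1"
  shows "2 * sinh (2 * speed d x * width d x) / speed d x < barrier d x"
proof -
  define r where "r = real_ramp d x"
  have r: "0 < r" "r \<le> 3"
    using real_ramp_pos real_ramp_le[OF assms] by (auto simp: r_def)
  have "2 * speed d x * width d x = 20 / r"
    using r by (simp add: speed_def width_def field_simps eval_nat_numeral flip: r_def)
  then have "2 * sinh (2 * speed d x * width d x) / speed d x = 2 * sinh (20 / r) * (r ^ 3 / 256000)"
    by (simp add: speed_def flip: r_def)
  also have "\<dots> < exp (20 / r) * (r ^ 3 / 256000)"
    using r by (intro mult_strict_right_mono) (auto simp: sinh_field_def)
  also have "\<dots> \<le> exp (20 / r) * (3 ^ 3 / 256000)"
    using r by (intro mult_left_mono divide_right_mono power_mono) auto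
  finally show ?thesis
    by (simp add: barrier_def r_def mult_ac)
qed

text \<open>With s = 10 / p the claim compares exp(2s) with sinh(4s) / s^3. The cube bound at 2s
  absorbs s^3, and p \<le> 3 makes 4s large enough for sinh to be nearly half the
  exponential.\<close>

lemma barrier_upper:
  assumes "\<bar>x\<bar> < 1"
  shows "barrier d x \<le> sinh (speed d x * outer_width d x / 2) / (4 * speed d x)"
proof -
  define r where "r = real_ramp d x"
  define s where "s = 10 / r"
  have r: "0 < r" "r \<le> 3"
    using real_ramp_pos real_ramp_le[OF assms] by (auto simp: r_def)
  then have s: "10/3 \<le> s" and rs: "r = 10 / s"
    by (auto simp: s_def field_simps)
  have s0: "0 < s"
    using s by simp
  have e4: "exp (4 * s) = exp (2 * s) * exp (2 * s)"
    by (simp flip: exp_add)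
  have "(2 * s / 3) ^ 3 \<le> exp (2 * s)"
    using s0 by (intro exp_ge_cube) auto
  then have "s ^ 3 \<le> 27/8 * exp (2 * s)"
    by (simp add: power_divide power_mult_distrib)
  then have "108 * exp (2 * s) * s ^ 3 \<le> 108 * exp (2 * s) * (27/8 * exp (2 * s))"
    by (intro mult_left_mono) auto
  also have "\<dots> = 729/2 * exp (4 * s)"
    by (simp add: e4)
  also have "\<dots> \<le> 500 * (exp (4 * s) - 1)"
  proof -
    have "10 \<le> exp (4 * s)"
      using exp_ge_add_one_self[of "4 * s"] s by linarith
    then show ?thesis
      by simp
  qed
  also have "\<dots> \<le> 1000 * sinh (4 * s)"
    using s0 by (simp add: sinh_field_def)
  finally have "108 * exp (2 * s) \<le> sinh (4 * s) * (1000 / s ^ 3)"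
    using s0 by (simp add: field_simps)
  also have "1000 / s ^ 3 = r ^ 3"
    by (simp add: rs power_divide)
  finally have "27 / 256000 * exp (2 * s) \<le> sinh (4 * s) * r ^ 3 / 1024000"
    by simp
  moreover have "speed d x * outer_width d x / 2 = 4 * s"
    using r by (simp add: speed_def outer_width_def s_def field_simps eval_nat_numeral flip: r_def)
  ultimately show ?thesis
    by (simp add: barrier_def speed_def s_def flip: r_def)
qed

lemma width_derivative: "(width d has_real_derivative width_deriv d x) (at x)"
  unfolding width_def[abs_def] width_deriv_def real_ramp_def[abs_def] using sqrt_pos[of x]
  by (auto intro!: derivative_eq_intros simp: field_simps)

lemma ex_helicoidal:
  "\<exists>G1 G2. helicoidal (slit_plane d) (height_map d) (height_deriv d) G1 G2
    (speed d) (width d) (width_deriv d) (outer_width d) (barrier d)"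
proof -
  have prim: "\<exists>G. (\<forall>z\<in>slit_plane d. (G has_field_derivative g z) (at z)) \<and> G 0 = 0"
    if "g holomorphic_on slit_plane d" for g
  proof -
    have "\<exists>G. \<forall>z\<in>slit_plane d. (G has_field_derivative g z) (at z)"
      using that open_slit_plane
      by (intro holomorphic_starlike_primitive[of _ _ "{}"] starlike_slit_plane holomorphic_on_imp_continuous_on)
        (auto simp: holomorphic_on_imp_differentiable_at)
    then obtain G where G: "\<forall>z\<in>slit_plane d. (G has_field_derivative g z) (at z)"
      by blast
    then show ?thesis
      by (intro exI[of _ "\<lambda>z. G z - G 0"]) (auto intro!: derivative_eq_intros)
  qed
  have hol: "height_map d holomorphic_on slit_plane d"
    using height_map_derivative open_slit_plane holomorphic_on_open by blast
  obtain G1 where G1: "\<And>z. z \<in> slit_plane d \<Longrightarrow> (G1 has_field_derivative - \<i> * sin (height_map d z)) (at z)" "G1 0 = 0"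
  proof -
    have "(\<lambda>z. - \<i> * sin (height_map d z)) holomorphic_on slit_plane d"
      by (intro holomorphic_intros hol)
    then show ?thesis
      using prim that by blast
  qed
  obtain G2 where G2: "\<And>z. z \<in> slit_plane d \<Longrightarrow> (G2 has_field_derivative \<i> * cos (height_map d z)) (at z)" "G2 0 = 0"
  proof -
    have "(\<lambda>z. \<i> * cos (height_map d z)) holomorphic_on slit_plane d"
      by (intro holomorphic_intros hol)
    then show ?thesis
      using prim that by blast
  qed
  have "helicoidal (slit_plane d) (height_map d) (height_deriv d) G1 G2
    (speed d) (width d) (width_deriv d) (outer_width d) (barrier d)"
  proof
    fix x y :: real
    show "0 < speed d x" "0 < width d x" "width d x < outer_width d x"
      using real_ramp_pos[of x] by (auto simp: speed_def width_def outer_width_def)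
    show "(width d has_real_derivative width_deriv d x) (at x)"
      by (rule width_derivative)
    show "continuous_on UNIV (width_deriv d)"
      unfolding width_deriv_def[abs_def] using sqrt_pos
      by (intro continuous_intros continuous_on_real_ramp) (auto simp: less_imp_neq[symmetric])
    show "continuous_on UNIV (outer_width d)"
      unfolding outer_width_def[abs_def] by (intro continuous_intros continuous_on_real_ramp) auto
    show "continuous_on UNIV (barrier d)"
      unfolding barrier_def[abs_def] using real_ramp_pos
      by (intro continuous_intros continuous_on_real_ramp) (auto simp: less_imp_neq[symmetric])
    show "barrier d y \<le> barrier d x" if "x \<le> y"
      using real_ramp_mono[OF that] real_ramp_pos[of x] by (auto simp: barrier_def intro: divide_left_mono)
    assume x: "\<bar>x\<bar> < 1"
    show "2 * sinh (2 * speed d x * width d x) / speed d x < barrier d x"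
      by (rule barrier_lower[OF x])
    show "barrier d x \<le> sinh (speed d x * outer_width d x / 2) / (4 * speed d x)"
      by (rule barrier_upper[OF x])
    assume y: "\<bar>y\<bar> \<le> outer_width d x"
    show "Complex x y \<in> slit_plane d"
      by (rule point_in_slit_plane[OF x y])
    show "\<bar>Re (height_map d (Complex x y)) - Re (height_map d (Complex x 0))\<bar> \<le> 1/2"
      by (rule height_map_rotation[OF x y])
    note close = height_deriv_close[OF x y]
    show "speed d x / 2 \<le> Re (height_deriv d (Complex x y))"
      using close abs_Re_le_cmod[of "height_deriv d (Complex x y) - of_real (speed d x)"] by auto
    have "0 < speed d x"
      using real_ramp_pos[of x] by (auto simp: speed_def)
    then show "norm (height_deriv d (Complex x y)) \<le> 2 * speed d x"
      using close norm_triangle_ineq[of "height_deriv d (Complex x y) - of_real (speed d x)" "of_real (speed d x)"] by simp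
  qed (use d G1 G2 open_slit_plane height_map_derivative height_map_cnj starlike_slit_plane in
      \<open>auto simp: slit_plane_def intro: starlike_imp_connected\<close>)
  then show ?thesis
    by blast
qed

text \<open>Here f Y / 2 = 5 / p. The slices therefore grow without bound where the ramp p tends to
  0, and elsewhere keep a radius bounded below, because p \<le> 3.\<close>

lemma radius_ge_ramp:
  assumes "helicoidal (slit_plane d) (height_map d) (height_deriv d) G1 G2
    (speed d) (width d) (width_deriv d) (outer_width d) (barrier d)" and "\<bar>x\<bar> < 1"
  shows "625 / 524288000 / real_ramp d x \<le> helicoidal.radius G1 G2 (width d) x"
proof -
  interpret helicoidal "slit_plane d" "height_map d" "height_deriv d" G1 G2
    "speed d" "width d" "width_deriv d" "outer_width d" "barrier d"
    by (rule assms(1))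
  define r where "r = real_ramp d x"
  have r: "0 < r"
    by (simp add: r_def real_ramp_pos)
  have "speed d x * width d x / 2 = 5 / r"
    using r by (simp add: speed_def width_def field_simps eval_nat_numeral flip: r_def)
  then have "sinh (5 / r) * (r ^ 3 / 1024000) \<le> radius x"
    using radius_ge[OF assms(2)] by (simp add: speed_def flip: r_def)
  moreover have "(5 / r) ^ 4 / 512 * (r ^ 3 / 1024000) \<le> sinh (5 / r) * (r ^ 3 / 1024000)"
    using r by (intro mult_right_mono sinh_ge_power4) auto
  moreover have "(5 / r) ^ 4 / 512 * (r ^ 3 / 1024000) = 625 / 524288000 / r"
    using r by (simp add: field_simps eval_nat_numeral)
  ultimately have "625 / 524288000 / r \<le> radius x"
    by linarith
  then show ?thesis
    unfolding r_def .
qed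

end

section \<open>The sequence of disks and its properties\<close>

theorem theorem1:
  shows "\<exists>(M :: nat \<Rightarrow> (real^3) set) (D :: nat \<Rightarrow> complex set) (F :: nat \<Rightarrow> complex \<Rightarrow> real^3).
    (\<forall>N. compact_embedded_minimal_disk (D N) (F N) (M N) \<and>
         M N \<subseteq> {p. - 1/2 \<le> p$3 \<and> p$3 \<le> 1/2} \<and>
         0 \<in> M N \<and>
         x3_segment (- 1/2) (1/2) \<subseteq> M N) \<and>
    (\<forall>p \<in> x3_segment (- 1/2) 0.
         filterlim (\<lambda>N. sff_norm_sq_at (D N) (F N) p) at_top sequentially) \<and>
    (\<forall>N. \<exists>M1 M2. multivalued_graph M1 \<and> multivalued_graph M2 \<and>
         M N - x3_segment (- 1/2) (1/2) = M1 \<union> M2) \<and>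
    (\<forall>\<delta>>0. (SUP N. SUP p \<in> M N - nbhd \<delta> (x3_segment (- 1/2) 0).
         ereal (sff_norm_sq_at (D N) (F N) p)) < \<infinity>) \<and>
    (\<exists>r0>0. \<forall>N. disk_boundary (D N) (F N) \<inter>
         {p. (p$1)\<^sup>2 + (p$2)\<^sup>2 \<le> r0\<^sup>2 \<and> - 1/2 < p$3 \<and> p$3 < 1/2} = {}) \<and>
    (\<forall>t. - 1/2 \<le> t \<and> t \<le> 0 \<longrightarrow>
         (\<forall>N. is_arc (slice (M N) t) \<and>
              (- 1/2 < t \<longrightarrow> arc_endpoints (slice (M N) t) = {p \<in> disk_boundary (D N) (F N). p$3 = t})) \<and>
         filterlim (\<lambda>N. setdist x3_axis (arc_endpoints (slice (M N) t))) at_top sequentially)"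
proof -
  \<comment> \<open>The smoothing scale tends to 0, and 1/d = N + 1 serves as an explicit rate of
    divergence.\<close>
  define d :: "nat \<Rightarrow> real" where "d N = 1 / (real N + 1)" for N
  have d: "0 < d N" "d N \<le> 1" for N
    by (auto simp: d_def)
  have "\<forall>N. \<exists>G. helicoidal (slit_plane (d N)) (height_map (d N)) (height_deriv (d N)) (fst G) (snd G)
    (speed (d N)) (width (d N)) (width_deriv (d N)) (outer_width (d N)) (barrier (d N))"
    using ex_helicoidal[OF d] by (metis fst_conv snd_conv)
  then obtain G where G: "\<And>N. helicoidal (slit_plane (d N)) (height_map (d N)) (height_deriv (d N)) (fst (G N)) (snd (G N))
    (speed (d N)) (width (d N)) (width_deriv (d N)) (outer_width (d N)) (barrier (d N))"
    by metis
  define D where "D N = helicoidal.disk (width (d N))" for N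
  define F where "F N = re_surface (fst (G N)) (snd (G N)) (\<lambda>z. z)" for N
  define M where "M N = F N ` D N" for N
  define \<kappa> :: real where "\<kappa> = 625 / 524288000"
  have \<kappa>: "0 < \<kappa>"
    by (simp add: \<kappa>_def)
  have F3: "F N z $ 3 = Re z" for N z
    using helicoidal.F_3[OF G, of N z] by (simp add: F_def)
  have D_iff: "z \<in> D N \<longleftrightarrow> \<bar>Re z\<bar> \<le> 1/2 \<and> \<bar>Im z\<bar> \<le> width (d N) (Re z)" for z N
    unfolding D_def helicoidal.disk_def[OF G] by simp
  have axis: "F N (Complex x 0) = vector [0, 0, x]" "Complex x 0 \<in> D N" if "\<bar>x\<bar> \<le> 1/2" for x N
    using helicoidal.F_axis_disk[OF G that] helicoidal.axis_in_disk[OF G that] by (auto simp: F_def D_def)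
  have zero: "(0 :: real^3) = vector [0, 0, 0]"
    by (simp add: vec_eq_iff forall_3 vector_3)
  have disk: "compact_embedded_minimal_disk (D N) (F N) (M N) \<and> M N \<subseteq> {p. - 1/2 \<le> p$3 \<and> p$3 \<le> 1/2} \<and>
      0 \<in> M N \<and> x3_segment (- 1/2) (1/2) \<subseteq> M N" for N
  proof (intro conjI)
    show "compact_embedded_minimal_disk (D N) (F N) (M N)"
      using helicoidal.compact_embedded_minimal_disk_F[OF G] by (simp add: F_def D_def M_def)
    show "M N \<subseteq> {p. - 1/2 \<le> p$3 \<and> p$3 \<le> 1/2}"
      by (auto simp: M_def F3 D_iff abs_le_iff)
    show seg: "x3_segment (- 1/2) (1/2) \<subseteq> M N"
      using helicoidal.x3_segment_subset[OF G] by (simp add: F_def D_def M_def)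
    have "(0 :: real^3) \<in> x3_segment (- 1/2) (1/2)"
      unfolding x3_segment_def zero by (intro CollectI exI[of _ 0]) simp
    then show "0 \<in> M N"
      using seg by blast
  qed
  have inv_d: "1 / d N = real N + 1" for N
    by (simp add: d_def)
  \<comment> \<open>At heights x \<le> 0 the ramp is at most d; both the curvature blow-up and the
    escape of the slice endpoints come from this.\<close>
  have ramp_large: "real N + 1 \<le> 1 / real_ramp (d N) x" if "x \<le> 0" for N x
    using real_ramp_le_nonpos[OF d that] real_ramp_pos[OF d] unfolding inv_d[symmetric] by (intro frac_le) auto
  have N1: "filterlim (\<lambda>N. real N + 1) at_top sequentially"
    by (rule filterlim_at_top_mono[OF filterlim_real_sequentially]) auto
  have blow_up: "filterlim (\<lambda>N. sff_norm_sq_at (D N) (F N) p) at_top sequentially"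
    if seg: "p \<in> x3_segment (- 1/2) 0" for p
  proof -
    obtain t where p: "p = vector [0, 0, t]" and t: "- 1/2 \<le> t" "t \<le> 0"
      using seg by (auto simp: x3_segment_def)
    have t': "\<bar>t\<bar> \<le> 1/2" "\<bar>t\<bar> < 1"
      using t by auto
    have "real N + 1 \<le> sff_norm_sq_at (D N) (F N) p" for N
    proof -
      interpret H: helicoidal "slit_plane (d N)" "height_map (d N)" "height_deriv (d N)" "fst (G N)" "snd (G N)"
        "speed (d N)" "width (d N)" "width_deriv (d N)" "outer_width (d N)" "barrier (d N)"
        by (rule G)
      let ?r = "real_ramp (d N) t"
      have "0 < ?r"
        by (rule real_ramp_pos[OF d])
      moreover have "1 \<le> 1 / ?r"
        using ramp_large[OF t(2), of N] by linarith
      ultimately have r: "0 < ?r" "1 \<le> 1 / ?r" .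
      \<comment> \<open>On the axis v = 0, so the cosh factor is 1.\<close>
      have "sff_norm_sq_at (D N) (F N) p = 2 * (norm (height_deriv (d N) (Complex t 0)))\<^sup>2"
        using H.sff_norm_sq_at_F[OF H.axis_in_disk[OF t'(1)]] H.F_axis_disk[OF t'(1)] H.v_axis[OF t'(2)]
        by (simp add: D_def F_def p)
      also have "height_deriv (d N) (Complex t 0) = of_real (256000 * (1 / ?r) ^ 3)"
      proof -
        have "Complex t 0 = of_real t"
          by (simp add: complex_eq_iff)
        then show ?thesis
          by (simp only: height_deriv_def ramp_of_real[OF d]) (simp add: power_divide)
      qed
      also have "norm (of_real (256000 * (1 / ?r) ^ 3) :: complex) = 256000 * (1 / ?r) ^ 3"
        unfolding norm_of_real using r by simp
      finally have "sff_norm_sq_at (D N) (F N) p = 2 * (256000 * (1 / ?r) ^ 3)\<^sup>2" .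
      \<comment> \<open>As 1/r \<ge> 1, the sixth power may be lowered to the first, which is at
        least N + 1.\<close>
      moreover have "1 / ?r \<le> (1 / ?r) ^ 6"
        using power_increasing[of 1 6 "1 / ?r"] r by simp
      moreover have "2 * (256000 * (1 / ?r) ^ 3)\<^sup>2 = 131072000000 * (1 / ?r) ^ 6"
        by (simp add: power_mult_distrib flip: power_mult)
      moreover have "0 \<le> (1 / ?r) ^ 6"
        using r by simp
      ultimately show ?thesis
        using ramp_large[OF t(2), of N] by linarith
    qed
    then show ?thesis
      by (intro filterlim_at_top_mono[OF N1]) auto
  qed
  have graphs: "\<exists>M1 M2. multivalued_graph M1 \<and> multivalued_graph M2 \<and> M N - x3_segment (- 1/2) (1/2) = M1 \<union> M2" for N
    using helicoidal.two_multivalued_graphs[OF G] by (simp add: F_def D_def M_def)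
  have bound: "(SUP N. SUP p \<in> M N - nbhd \<delta> (x3_segment (- 1/2) 0). ereal (sff_norm_sq_at (D N) (F N) p)) < \<infinity>"
    if \<delta>: "\<delta> > 0" for \<delta>
  proof -
    \<comment> \<open>One term for each part of \<open>curvature_bounds\<close>: heights at least
      \<delta>/2, where the ramp is at least \<delta>/2, and the remaining points, which lie at
      distance at least \<delta>/2 from the axis. Neither term involves \<open>N\<close>.\<close>
    define C where "C = max (8 * (256000 / (\<delta> / 2) ^ 3)\<^sup>2) (32 / (\<delta> / 2)\<^sup>2)"
    have "sff_norm_sq_at (D N) (F N) p \<le> C" if p: "p \<in> M N - nbhd \<delta> (x3_segment (- 1/2) 0)" for p N
    proof -
      interpret H: helicoidal "slit_plane (d N)" "height_map (d N)" "height_deriv (d N)" "fst (G N)" "snd (G N)"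
        "speed (d N)" "width (d N)" "width_deriv (d N)" "outer_width (d N)" "barrier (d N)"
        by (rule G)
      obtain z where z: "z \<in> H.disk" "p = H.F z"
        using p by (auto simp: M_def D_def F_def)
      show ?thesis
      proof (cases "\<delta> / 2 \<le> Re z")
        case True
        have "speed (d N) (Re z) \<le> 256000 / (\<delta> / 2) ^ 3"
          unfolding speed_def using True \<delta> le_real_ramp[OF d, of "Re z" N]
          by (intro divide_left_mono power_mono mult_pos_pos zero_less_power) auto
        then have "(speed (d N) (Re z))\<^sup>2 \<le> (256000 / (\<delta> / 2) ^ 3)\<^sup>2"
          using H.f_pos[of "Re z"] by (intro power_mono) auto
        then show ?thesis
          using H.curvature_bounds(1)[OF z(1)] z(2) by (simp add: C_def D_def F_def)
      next
        case False
        have W: "\<delta> / 2 \<le> norm (H.W z)"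
        proof (rule ccontr)
          assume W: "\<not> \<delta> / 2 \<le> norm (H.W z)"
          \<comment> \<open>The segment point at the height of \<open>p\<close>, capped at 0. The
            vertical gap and the distance of \<open>p\<close> from the axis are both below
            \<delta>/2.\<close>
          define q :: "real^3" where "q = vector [0, 0, min (Re z) 0]"
          have "- 1/2 \<le> Re z"
            using z(1) by (auto simp: H.disk_def)
          then have "q \<in> x3_segment (- 1/2) 0"
            unfolding x3_segment_def q_def by (intro CollectI exI[of _ "min (Re z) 0"]) auto
          moreover have "dist q p < \<delta>"
          proof -
            have "dist q p = sqrt ((Re (H.W z))\<^sup>2 + (Im (H.W z))\<^sup>2 + (min (Re z) 0 - Re z)\<^sup>2)"
              by (simp add: dist_norm norm_vec_def L2_set_def sum_3 q_def z(2) H.F_W vector_3)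
            also have "\<dots> = sqrt ((norm (H.W z))\<^sup>2 + (min (Re z) 0 - Re z)\<^sup>2)"
              by (simp add: cmod_power2)
            also have "\<dots> \<le> \<bar>norm (H.W z)\<bar> + \<bar>min (Re z) 0 - Re z\<bar>"
              by (rule sqrt_sum_squares_le_sum_abs)
            also have "\<dots> < \<delta>"
              using W False \<delta> by (auto simp: min_def)
            finally show ?thesis .
          qed
          ultimately show False
            using p by (auto simp: nbhd_def)
        qed
        then have "sff_norm_sq_at H.disk H.F p \<le> 32 / (norm (H.W z))\<^sup>2"
          using H.curvature_bounds(2)[OF z(1)] z(2) \<delta> by force
        also have "\<dots> \<le> 32 / (\<delta> / 2)\<^sup>2"
          using W \<delta> by (intro divide_left_mono power_mono mult_pos_pos zero_less_power) auto
        finally show ?thesis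
          by (simp add: C_def D_def F_def)
      qed
    qed
    then have "(SUP N. SUP p \<in> M N - nbhd \<delta> (x3_segment (- 1/2) 0). ereal (sff_norm_sq_at (D N) (F N) p)) \<le> ereal C"
      by (intro SUP_least) simp
    then show ?thesis
      by (rule le_less_trans) simp
  qed
  have radius: "\<kappa> / real_ramp (d N) x \<le> helicoidal.radius (fst (G N)) (snd (G N)) (width (d N)) x" if "\<bar>x\<bar> < 1" for x N
    using radius_ge_ramp[OF d G that] by (simp add: \<kappa>_def)
  \<comment> \<open>The ramp is at most 3, so every radius is at least \<kappa>/3; the choice r0 =
    \<kappa>/6 makes the inequality strict.\<close>
  have boundary: "disk_boundary (D N) (F N) \<inter>
      {p. (p$1)\<^sup>2 + (p$2)\<^sup>2 \<le> (\<kappa> / 6)\<^sup>2 \<and> - 1/2 < p$3 \<and> p$3 < 1/2} = {}" for N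
  proof -
    have False if p: "p \<in> disk_boundary (D N) (F N)" "(p$1)\<^sup>2 + (p$2)\<^sup>2 \<le> (\<kappa> / 6)\<^sup>2" "- 1/2 < p$3" "p$3 < 1/2" for p
    proof -
      let ?R = "helicoidal.radius (fst (G N)) (snd (G N)) (width (d N)) (p$3)"
      have x: "\<bar>p$3\<bar> < 1"
        using p by auto
      have "\<kappa> / 6 < \<kappa> / 3"
        using \<kappa> by simp
      also have "\<dots> \<le> \<kappa> / real_ramp (d N) (p$3)"
        using \<kappa> real_ramp_pos[OF d] real_ramp_le[OF d x] by (intro divide_left_mono) auto
      also have "\<dots> \<le> ?R"
        by (rule radius[OF x])
      finally have "(\<kappa> / 6)\<^sup>2 < ?R\<^sup>2"
        using \<kappa> by (intro power_strict_mono) auto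
      then show False
        using helicoidal.disk_boundary_point[OF G, of p N] p by (simp add: D_def F_def)
    qed
    then show ?thesis
      by blast
  qed
  have slices: "(\<forall>N. is_arc (slice (M N) t) \<and>
        (- 1/2 < t \<longrightarrow> arc_endpoints (slice (M N) t) = {p \<in> disk_boundary (D N) (F N). p$3 = t})) \<and>
      filterlim (\<lambda>N. setdist x3_axis (arc_endpoints (slice (M N) t))) at_top sequentially"
    if t: "- 1/2 \<le> t \<and> t \<le> 0" for t
  proof (intro conjI allI impI)
    have t': "\<bar>t\<bar> \<le> 1/2" "\<bar>t\<bar> < 1"
      using t by auto
    show "is_arc (slice (M N) t)" for N
      using helicoidal.is_arc_slice[OF G t'(1)] by (simp add: F_def D_def M_def)
    show "arc_endpoints (slice (M N) t) = {p \<in> disk_boundary (D N) (F N). p$3 = t}" if "- 1/2 < t" for N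
      using helicoidal.arc_endpoints_slice_boundary[OF G t'(1) that] t by (simp add: F_def D_def M_def)
    have "\<kappa> * (real N + 1) \<le> setdist x3_axis (arc_endpoints (slice (M N) t))" for N
    proof -
      have "\<kappa> * (real N + 1) \<le> \<kappa> * (1 / real_ramp (d N) t)"
        using ramp_large[of t N] t \<kappa> by (intro mult_left_mono) auto
      also have "\<dots> \<le> helicoidal.radius (fst (G N)) (snd (G N)) (width (d N)) t"
        using radius[OF t'(2)] by simp
      also have "\<dots> \<le> setdist x3_axis (arc_endpoints (slice (M N) t))"
        using helicoidal.radius_le_setdist[OF G t'(1)] by (simp add: F_def D_def M_def)
      finally show ?thesis .
    qed
    then show "filterlim (\<lambda>N. setdist x3_axis (arc_endpoints (slice (M N) t))) at_top sequentially"
      by (intro filterlim_at_top_mono[OF filterlim_tendsto_pos_mult_at_top[OF tendsto_const \<kappa> N1]]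
          always_eventually allI)
  qed
  have "\<exists>r0>0. \<forall>N. disk_boundary (D N) (F N) \<inter>
      {p. (p$1)\<^sup>2 + (p$2)\<^sup>2 \<le> r0\<^sup>2 \<and> - 1/2 < p$3 \<and> p$3 < 1/2} = {}"
    using boundary \<kappa> by (intro exI[of _ "\<kappa> / 6"]) simp
  note all_parts = conjI[OF allI[OF disk] conjI[OF ballI[OF blow_up] conjI[OF allI[OF graphs]
        conjI[OF allI[OF impI[OF bound]] conjI[OF this allI[OF impI[OF slices]]]]]]]
  show ?thesis
    by (rule exI[of _ M], rule exI[of _ D], rule exI[of _ F]) (rule all_parts)
qed

end
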